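(* Let $n\ge1$ be an integer, $0<\alpha\le 2$, and $p_\alpha=1+\alpha/n$. There exists a function $f\colon[0,\infty)\to[0,\infty)$ satisfying (M) $f$ is locally Lipschitz continuous, non-decreasing and $f(0)=0$; (C) $f$ is convex on $(0,\infty)$; (B) $\displaystyle\int_1^\infty\frac{1}{f(u)}\,du<\infty$; (S) there exist $c_0,\mu_0>0$ and $g\colon(\mu_0,\infty)\to(0,\infty)$ such that $\int_{\mu_0}^\infty\frac{1}{g(s)}\,ds<\infty$ and $f(\lambda\mu)\ge g(\mu)f(\lambda)$ for all $\lambda>0$ and $\mu\ge\mu_0$ with $\lambda\mu\in(0,c_0)$; and $\displaystyle\int_{0^+}\frac{f(u)}{u^{2+\alpha/n}}\,du=\infty$, such that the PDE $u_t=\Delta_\alpha u+f(u)$, $u(0)=\phi$, on $\mathbb{R}^n$ has the blow-up property, and yet $$\liminf_{u\to0^+}\frac{f(u)}{u^{p_\alpha}}=0\qquad\text{and}\qquad\liminf_{\lambda\to0^+}\frac{f(\lambda^2)}{\lambda^{p_\alpha}f(\lambda)}=0.$$ In particular, when $\alpha=2$ (so $p_\alpha=1+2/n$), there is no $c_0\in(0,1]$ such that $f(\lambda\mu)\ge c_0\mu^{1+2/n}f(\lambda)$ for all $\lambda,\mu$ with $0<\lambda\le\mu$, $\lambda\in(0,c_0)$ and $\lambda\mu\in(0,c_0)$.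
   Context: $\Delta_\alpha=-(-\Delta)^{\alpha/2}$ denotes the fractional Laplacian on $\mathbb{R}^n$, and $K_\alpha(x,t)$ is the (positive) fractional heat kernel, i.e. $K_\alpha(\cdot,t)$ is the function whose Fourier transform is $e^{-t|\xi|^\alpha}$, normalized so that $\int_{\mathbb{R}^n}K_\alpha(x,t)\,dx=1$. The fractional heat semigroup is $[S_\alpha(t)\phi](x)=\int_{\mathbb{R}^n}K_\alpha(x-y,t)\phi(y)\,dy$. Solutions of the PDE are understood via the variation of constants formula $$u(t)=S_\alpha(t)\phi+\int_0^tS_\alpha(t-s)f(u(s))\,ds.$$ It is well known that, when $f$ satisfies (M), for any non-negative $\phi\in L^\infty(\mathbb{R}^n)$ there is a maximal existence time $T_\phi\in(0,\infty]$ such that the PDE has a unique non-negative solution $u$ on $[0,T_\phi)$ that is bounded on $\mathbb{R}^n\times[0,T]$ for every $T\in(0,T_\phi)$, and if $T_\phi<\infty$ then $\|u(t)\|_\infty\to\infty$ as $t\to T_\phi$. The PDE has the blow-up property if $T_\phi<\infty$ for every non-trivial, non-negative $\phi\in L^\infty(\mathbb{R}^n)$. The notation $\int_{0^+}h(u)\,du=\infty$ means $\int_0^\delta h(u)\,du=\infty$ for (all) small $\delta>0$. *)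

theory Defs
  imports "HOL-Analysis.Analysis"
begin

definition fourier_transform :: "('a::euclidean_space \<Rightarrow> real) \<Rightarrow> 'a \<Rightarrow> complex" where
  "fourier_transform h \<xi> = (LINT x|lborel. cis (- (x \<bullet> \<xi>)) * complex_of_real (h x))"

text \<open>The kernel at time \<open>t > 0\<close> is pinned down by its Fourier transform; continuity selects the
  representative of the \<open>L\<^sup>1\<close> class. The normalisation of total mass \<open>1\<close> is the case \<open>\<xi> = 0\<close>.\<close>

definition frac_heat_kernel :: "real \<Rightarrow> 'a::euclidean_space \<Rightarrow> real \<Rightarrow> real" where
  "frac_heat_kernel \<alpha> x t =
    (THE K. continuous_on UNIV K \<and> integrable lborel K \<and>
       (\<forall>\<xi>. fourier_transform K \<xi> = complex_of_real (exp (- t * norm \<xi> powr \<alpha>)))) x"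

definition frac_heat_semigroup ::
    "real \<Rightarrow> real \<Rightarrow> ('a::euclidean_space \<Rightarrow> real) \<Rightarrow> 'a \<Rightarrow> real" where
  "frac_heat_semigroup \<alpha> t \<phi> x =
    (if t = 0 then \<phi> x else LINT y|lborel. frac_heat_kernel \<alpha> (x - y) t * \<phi> y)"

text \<open>Non-negative mild solution \<open>u\<close> on \<open>[0,T)\<close>, bounded on \<open>[0,T']\<close> for every \<open>T' < T\<close>.
  Elements of \<open>L\<^sup>\<infinity>\<close> are represented by Borel functions. The variation of constants formula holds
  in \<open>L\<^sup>\<infinity>\<close>, that is, almost everywhere in space for every time; at \<open>t = 0\<close> it is the initial
  condition. The representative of \<open>u\<close> is non-negative and bounded everywhere, not only almost
  everywhere, so that the values of \<open>f\<close> outside \<open>[0,\<infinity>)\<close> are irrelevant.\<close>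

definition mild_solution ::
    "real \<Rightarrow> (real \<Rightarrow> real) \<Rightarrow> ('a::euclidean_space \<Rightarrow> real) \<Rightarrow> ereal \<Rightarrow> (real \<Rightarrow> 'a \<Rightarrow> real) \<Rightarrow> bool" where
  "mild_solution \<alpha> f \<phi> T u \<longleftrightarrow>
     set_borel_measurable borel ({t. 0 \<le> t \<and> ereal t < T} \<times> UNIV) (\<lambda>(t, x). u t x) \<and>
     (\<forall>t x. 0 \<le> t \<and> ereal t < T \<longrightarrow> 0 \<le> u t x) \<and>
     (\<forall>T'. 0 < T' \<and> ereal T' < T \<longrightarrow> (\<exists>M. \<forall>t\<in>{0..T'}. \<forall>x. u t x \<le> M)) \<and>
     (\<forall>t. 0 \<le> t \<and> ereal t < T \<longrightarrow>
        (AE x in lborel. u t x = frac_heat_semigroup \<alpha> t \<phi> x +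
           (LINT s:{0..t}|lborel. frac_heat_semigroup \<alpha> (t - s) (\<lambda>y. f (u s y)) x)))"

definition max_existence_time ::
    "real \<Rightarrow> (real \<Rightarrow> real) \<Rightarrow> ('a::euclidean_space \<Rightarrow> real) \<Rightarrow> ereal" where
  "max_existence_time \<alpha> f \<phi> = Sup {T. 0 < T \<and> (\<exists>u. mild_solution \<alpha> f \<phi> T u)}"

definition blow_up_property :: "'a::euclidean_space itself \<Rightarrow> real \<Rightarrow> (real \<Rightarrow> real) \<Rightarrow> bool" where
  "blow_up_property _ \<alpha> f \<longleftrightarrow>
     (\<forall>\<phi> :: 'a \<Rightarrow> real.
        \<phi> \<in> borel_measurable lborel \<and> (\<exists>M. AE x in lborel. 0 \<le> \<phi> x \<and> \<phi> x \<le> M) \<and>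
        \<not> (AE x in lborel. \<phi> x = 0) \<longrightarrow>
        max_existence_time \<alpha> f \<phi> < \<infinity>)"

definition condition_M :: "(real \<Rightarrow> real) \<Rightarrow> bool" where
  "condition_M f \<longleftrightarrow>
     (\<forall>u\<ge>0. \<exists>r>0. \<exists>L. L-lipschitz_on (cball u r \<inter> {0..}) f) \<and> mono_on {0..} f \<and> f 0 = 0"

text \<open>Division is taken in \<^typ>\<open>ennreal\<close>, where \<open>1 / 0 = \<infinity>\<close>.\<close>

definition condition_B :: "(real \<Rightarrow> real) \<Rightarrow> bool" where
  "condition_B f \<longleftrightarrow> (\<integral>\<^sup>+u\<in>{1..}. 1 / ennreal (f u) \<partial>lborel) < \<infinity>"

text \<open>The inequality is also required at \<open>m = m0\<close>, so \<open>g\<close> is taken to be positive there as well.\<close>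

definition condition_S :: "(real \<Rightarrow> real) \<Rightarrow> bool" where
  "condition_S f \<longleftrightarrow>
     (\<exists>c0 m0 g. 0 < c0 \<and> 0 < m0 \<and> g \<in> {m0..} \<rightarrow> {0<..} \<and>
        set_integrable lborel {m0<..} (\<lambda>s. 1 / g s) \<and>
        (\<forall>l m. 0 < l \<and> m0 \<le> m \<and> l * m \<in> {0<..<c0} \<longrightarrow> g m * f l \<le> f (l * m)))"

end

theory Submission
  imports Defs "HOL-Probability.Probability"
begin

text \<open>
  With \<open>\<theta> = \<alpha> / (3 n)\<close>, so that \<open>p\<^sub>\<alpha> = 1 + 3 \<theta>\<close>, and \<open>d\<^sub>k = 2 powr (- 4\<^sup>k)\<close> take
  \<open>f u = (\<Sum>k. d\<^sub>k powr \<theta> * (max 0 (u - d\<^sub>k)) powr (1 + \<theta>))\<close>. Each summand is convex and satisfies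
  \<open>f (\<lambda> \<mu>) \<ge> \<mu> powr (1 + \<theta>) f \<lambda>\<close> for \<open>\<mu> \<ge> 1\<close>, while \<open>f u / u powr p\<^sub>\<alpha>\<close> is unbounded along \<open>u = 2 d\<^sub>k\<close> and tends
  to \<open>0\<close> along \<open>u = d\<^sub>k\<close>.

  Unboundedness of \<open>f u / u powr p\<^sub>\<alpha>\<close> as \<open>u \<rightarrow> 0\<close> forces blow-up. By Jensen's inequality and the semigroup
  law, \<open>w s = [S\<^sub>\<alpha>(t - s) u(s)](0)\<close> satisfies \<open>w s \<ge> w 0 + \<integral>\<^sub>0\<^sup>s f (w r) dr\<close>, so a solution on \<open>[0, t]\<close> needs
  \<open>t f (w 0) / w 0\<close> to stay bounded. But \<open>w 0 \<ge> C t powr (- n / \<alpha>)\<close> for large \<open>t\<close>, and choosing \<open>t\<close> such that this lower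
  bound equals \<open>2 d\<^sub>k\<close> makes the quotient a multiple of \<open>f u / u powr p\<^sub>\<alpha>\<close> at \<open>u = 2 d\<^sub>k\<close>.

  Non-negativity of the kernel comes from writing \<open>exp (- t |\<xi>| powr \<alpha>)\<close> as a limit of power series with
  non-negative coefficients in Gaussians; integrability and the Fourier inversion formula then
  follow by monotone convergence.
\<close>

section \<open>The oscillating nonlinearity\<close>

text \<open>The exponents leave slack. With nodes obeying d_{k+1} = d_k^q, the tail of the series at
  d_k has order \<open>d_k powr (1 + (1 + q) * \<theta>)\<close>, which beats the critical power
  \<open>1 + 3 * \<theta>\<close> as soon as q > 2; here q = 4. The same surplus settles the second
  limit inferior, because at the square root l of d_k the k-th term alone keeps f l at least of the
  critical size \<open>l powr (1 + 3 * \<theta>)\<close>. Powers \<open>1 + \<theta>\<close> in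
  place of linear pieces supply the superlinear growth behind (B), (S) and the finite total of the
  doubling times.

  Two obstacles shape the analysis. The heat kernel is a definite description through its Fourier
  transform, so its existence, uniqueness, sign and mass must be established before it can serve as
  a probability density in Jensen's inequality. Moreover the variation of constants formula holds
  only almost everywhere in space, separately for each time, with Bochner integrals. It is therefore
  replaced by inequalities between non-negative integrals of a jointly measurable function, to which
  Tonelli's theorem applies.\<close>

definition pos_powr :: "real \<Rightarrow> real \<Rightarrow> real" where
  "pos_powr q u = max 0 u powr q"

lemma pos_powr_nonneg [simp]: "0 \<le> pos_powr q u"
  by (simp add: pos_powr_def)

lemma pos_powr_eq_0 [simp]: "u \<le> 0 \<Longrightarrow> pos_powr q u = 0"
  by (simp add: pos_powr_def)

lemma pos_powr_mono: "q \<ge> 0 \<Longrightarrow> u \<le> v \<Longrightarrow> pos_powr q u \<le> pos_powr q v"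
  unfolding pos_powr_def by (intro powr_mono2) auto

text \<open>Between positive points this is the usual convexity of the power. If one of the points
  is 0, it reduces to \<open>t powr q \<le> t\<close> on the unit interval.\<close>

lemma powr_convex_nonneg:
  fixes q :: real
  assumes q: "q \<ge> 1" and "x \<ge> 0" "y \<ge> 0" "s \<ge> 0" "t \<ge> 0" "s + t = 1"
  shows "(s * x + t * y) powr q \<le> s * x powr q + t * y powr q"
proof -
  have le: "r powr q \<le> r" if "0 \<le> r" "r \<le> 1" for r :: real
    using powr_mono'[of 1 q r] q that by simp
  consider "x = 0" | "y = 0" | "x > 0" "y > 0" using assms by linarith
  then show ?thesis
  proof cases
    case 1
    have "t powr q * y powr q \<le> t * y powr q"
      using le[of t] assms by (intro mult_right_mono) auto
    then show ?thesis using 1 assms by (simp add: powr_mult)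
  next
    case 2
    have "s powr q * x powr q \<le> s * x powr q"
      using le[of s] assms by (intro mult_right_mono) auto
    then show ?thesis using 2 assms by (simp add: powr_mult)
  next
    case 3
    have s: "s = 1 - t" using assms by linarith
    show ?thesis
      unfolding s using convex_onD[OF powr_convex[OF q], of t x y] 3 assms by simp
  qed
qed

text \<open>Truncation at 0 gives convexity on the whole line, so that translates by nodes stay
  convex and Jensen's inequality can later be applied on \<open>UNIV\<close>.\<close>

lemma pos_powr_convex:
  assumes q: "q \<ge> 1"
  shows "convex_on UNIV (pos_powr q)"
proof (intro convex_onI)
  fix t x y :: real assume t: "0 < t" "t < 1"
  have "max 0 ((1 - t) * x + t * y) \<le> (1 - t) * max 0 x + t * max 0 y"
    using t by (intro max.boundedI add_mono mult_left_mono add_nonneg_nonneg) auto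
  then have "max 0 ((1 - t) * x + t * y) powr q \<le> ((1 - t) * max 0 x + t * max 0 y) powr q"
    using q by (intro powr_mono2) auto
  also have "\<dots> \<le> (1 - t) * max 0 x powr q + t * max 0 y powr q"
    using t q by (intro powr_convex_nonneg) auto
  finally show "pos_powr q ((1 - t) *\<^sub>R x + t *\<^sub>R y) \<le> (1 - t) * pos_powr q x + t * pos_powr q y"
    by (simp add: pos_powr_def)
qed auto

text \<open>Homogeneity moves m inside the truncated power, and the resulting shift m * d is at
  least d. This is the source of condition (S).\<close>

lemma pos_powr_scale:
  assumes "q \<ge> 0" "d \<ge> 0" "m \<ge> 1"
  shows "m powr q * pos_powr q (l - d) \<le> pos_powr q (l * m - d)"
proof -
  have "m powr q * pos_powr q (l - d) = pos_powr q (m * (l - d))"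
    using assms by (auto simp: pos_powr_def powr_mult max_def zero_le_mult_iff mult_le_0_iff)
  also have "\<dots> \<le> pos_powr q (l * m - d)"
  proof (rule pos_powr_mono)
    have "d * 1 \<le> d * m" using assms by (intro mult_left_mono) auto
    then show "m * (l - d) \<le> l * m - d" by (simp add: algebra_simps)
  qed fact
  finally show ?thesis .
qed

text \<open>Chord slopes of a convex function increase, so a chord inside \<open>{..R}\<close> is no
  steeper than the chord from its right end to \<open>R + 1\<close>. The latter has length at least
  1 and rise at most \<open>f (R + 1)\<close>.\<close>

lemma convex_mono_lipschitz:
  fixes f :: "real \<Rightarrow> real"
  assumes f: "convex_on UNIV f" and mono: "\<And>x y. x \<le> y \<Longrightarrow> f x \<le> f y" and 0: "\<And>x. 0 \<le> f x"
  shows "(f (R + 1))-lipschitz_on {..R} f"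
proof (rule lipschitz_onI)
  have *: "f y - f x \<le> f (R + 1) * (y - x)" if "x < y" "y \<le> R" for x y
  proof -
    have "(f x - f y) / (x - y) \<le> (f x - f (R + 1)) / (x - (R + 1))"
      using convex_on_slope_le(1)[OF f, of x "R + 1" y] that by simp
    also have "\<dots> \<le> (f y - f (R + 1)) / (y - (R + 1))"
      using convex_on_slope_le(2)[OF f, of x "R + 1" y] that by simp
    also have "\<dots> = (f (R + 1) - f y) / (R + 1 - y)" using that minus_divide_divide[of "f (R + 1) - f y" "R + 1 - y"] by simp
    also have "\<dots> \<le> f (R + 1)"
    proof -
      have "f (R + 1) - f y \<le> f (R + 1) * 1" using 0 by simp
      also have "\<dots> \<le> f (R + 1) * (R + 1 - y)" using 0 that by (intro mult_left_mono) auto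
      finally show ?thesis using that by (simp add: divide_simps)
    qed
    finally show ?thesis using that by (simp add: divide_simps algebra_simps split: if_splits)
  qed
  fix x y assume xy: "x \<in> {..R}" "y \<in> {..R}"
  consider "x < y" | "x = y" | "y < x" by linarith
  then show "dist (f x) (f y) \<le> f (R + 1) * dist x y"
    using xy *[of x y] *[of y x] mono[of x y] mono[of y x] by cases (auto simp: dist_real_def)
qed (use 0 in auto)

section \<open>Rapidly decreasing nodes\<close>

definition node :: "nat \<Rightarrow> real" where
  "node k = (1 / 2) ^ (4 ^ k)"

lemma node_pos [simp]: "0 < node k"
  by (simp add: node_def)

lemma node_nonneg [simp]: "0 \<le> node k"
  by (simp add: node_def)

lemma node_Suc: "node (Suc k) = node k ^ 4"
  by (simp add: node_def power_mult[symmetric] mult.commute)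

lemma Suc_le_four_power: "Suc k \<le> 4 ^ k"
  by (induction k) auto

text \<open>Of the much faster decay only a geometric rate is kept, through 4^k * 4^i \<ge> 4^k * (1
  + i) \<ge> 4^k + i. It gives tails a geometric majorant whose ratio does not depend on k.\<close>

lemma node_add_le: "node (k + i) \<le> node k * (1 / 2) ^ i"
proof -
  have "4 ^ k * Suc i \<le> (4 ^ k * 4 ^ i :: nat)" by (intro mult_left_mono Suc_le_four_power) auto
  moreover have "(i :: nat) \<le> 4 ^ k * i" by simp
  ultimately have "4 ^ k + i \<le> (4 ^ (k + i) :: nat)"
    unfolding power_add mult_Suc_right by linarith
  then have "(1 / 2 :: real) ^ (4 ^ (k + i)) \<le> (1 / 2) ^ (4 ^ k + i)" by (intro power_decreasing) auto
  then show ?thesis by (simp add: node_def power_add)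
qed

lemma node_0 [simp]: "node 0 = 1 / 2"
  by (simp add: node_def)

lemma node_le_power: "node k \<le> (1 / 2) ^ Suc k"
  using node_add_le[of 0 k] by simp

lemma node_le_half: "node k \<le> 1 / 2"
  using node_le_power[of k] power_decreasing[of 1 "Suc k" "1/2 :: real"] by simp

lemma node_antimono: "i \<le> j \<Longrightarrow> node j \<le> node i"
  unfolding node_def by (intro power_decreasing power_increasing) auto

lemma node_tendsto_0: "node \<longlonglongrightarrow> 0"
proof (rule tendsto_sandwich[OF _ _ tendsto_const])
  show "(\<lambda>k. (1 / 2 :: real) ^ Suc k) \<longlonglongrightarrow> 0" by (intro LIMSEQ_Suc LIMSEQ_power_zero) auto
  show "\<forall>\<^sub>F k in sequentially. node k \<le> (1 / 2) ^ Suc k"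
    using node_le_power by (intro always_eventually) blast
qed auto

lemma half_powr_lt_1: "\<theta> > 0 \<Longrightarrow> (1 / 2 :: real) powr \<theta> < 1"
  using powr_less_mono'[of "1/2" 0 \<theta>] by simp

lemma summable_half_powr: "\<theta> > 0 \<Longrightarrow> summable (\<lambda>i. ((1 / 2 :: real) powr \<theta>) ^ i)"
  using half_powr_lt_1 by (intro summable_geometric) auto

lemma node_powr_add_le:
  assumes "\<theta> > 0"
  shows "node (k + i) powr \<theta> \<le> node k powr \<theta> * ((1 / 2) powr \<theta>) ^ i"
proof -
  have "node (k + i) powr \<theta> \<le> (node k * (1 / 2) ^ i) powr \<theta>"
    using assms by (intro powr_mono2 node_add_le) auto
  also have "\<dots> = node k powr \<theta> * ((1 / 2) powr \<theta>) ^ i"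
    by (simp add: powr_mult powr_power powr_powr flip: powr_realpow)
       (simp add: mult.commute)
  finally show ?thesis .
qed

lemma summable_node_powr_shift:
  assumes "\<theta> > 0" shows "summable (\<lambda>i. node (k + i) powr \<theta>)"
proof (rule summable_comparison_test'[where N = 0])
  show "summable (\<lambda>i. node k powr \<theta> * ((1 / 2) powr \<theta>) ^ i)"
    by (rule summable_mult[OF summable_half_powr[OF assms]])
qed (use node_powr_add_le[OF assms] in simp)

lemma summable_node_powr: "\<theta> > 0 \<Longrightarrow> summable (\<lambda>k. node k powr \<theta>)"
  using summable_node_powr_shift[of \<theta> 0] by simp

text \<open>Put \<open>p = 1 + 3 \<theta>\<close> and write \<open>d\<close> for \<^term>\<open>node k\<close>. At \<open>2 d\<close> the term of index \<open>k\<close> alone has size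
  \<open>d powr (1 + 2 \<theta>)\<close>, far above \<open>d powr p\<close>. At \<open>d\<close> only the terms of larger index are left, and their
  coefficients are at most of order \<open>d powr (4 \<theta>)\<close>, so the value is far below \<open>d powr p\<close>.\<close>

definition osc :: "real \<Rightarrow> real \<Rightarrow> real" where
  "osc \<theta> u = (\<Sum>k. node k powr \<theta> * pos_powr (1 + \<theta>) (u - node k))"

section \<open>Regularity, growth and oscillation of the nonlinearity\<close>

context
  fixes \<theta> :: real
  assumes \<theta>: "\<theta> > 0"
begin

lemma osc_summable: "summable (\<lambda>k. node k powr \<theta> * pos_powr (1 + \<theta>) (u - node k))"
proof (rule summable_comparison_test'[where N = 0])
  show "summable (\<lambda>k. node k powr \<theta> * pos_powr (1 + \<theta>) u)"
    by (intro summable_mult2 summable_node_powr \<theta>)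
  show "norm (node n powr \<theta> * pos_powr (1 + \<theta>) (u - node n)) \<le> node n powr \<theta> * pos_powr (1 + \<theta>) u" for n
    using \<theta> by (auto intro!: mult_left_mono pos_powr_mono)
qed

lemma osc_nonneg [simp]: "0 \<le> osc \<theta> u"
  unfolding osc_def by (intro suminf_nonneg osc_summable) auto

lemma osc_eq_0 [simp]: "u \<le> 0 \<Longrightarrow> osc \<theta> u = 0"
  unfolding osc_def by (subst pos_powr_eq_0) (auto intro: order_trans[OF _ node_nonneg])

lemma osc_mono: "u \<le> v \<Longrightarrow> osc \<theta> u \<le> osc \<theta> v"
  unfolding osc_def using \<theta>
  by (intro suminf_le osc_summable mult_left_mono pos_powr_mono) auto

lemma osc_ge: "node k powr \<theta> * pos_powr (1 + \<theta>) (u - node k) \<le> osc \<theta> u"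
  using sum_le_suminf[OF osc_summable, of "{k}" u] by (simp add: osc_def)

lemma osc_convex: "convex_on UNIV (osc \<theta>)"
proof (intro convex_onI)
  fix t x y :: real assume t: "0 < t" "t < 1"
  have "osc \<theta> ((1 - t) *\<^sub>R x + t *\<^sub>R y) \<le>
    (\<Sum>k. (1 - t) * (node k powr \<theta> * pos_powr (1 + \<theta>) (x - node k)) +
         t * (node k powr \<theta> * pos_powr (1 + \<theta>) (y - node k)))"
    unfolding osc_def
  proof (intro suminf_le osc_summable summable_add summable_mult)
    fix k
    have "pos_powr (1 + \<theta>) ((1 - t) *\<^sub>R x + t *\<^sub>R y - node k) =
      pos_powr (1 + \<theta>) ((1 - t) *\<^sub>R (x - node k) + t *\<^sub>R (y - node k))"
      by (simp add: algebra_simps)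
    also have "\<dots> \<le> (1 - t) * pos_powr (1 + \<theta>) (x - node k) + t * pos_powr (1 + \<theta>) (y - node k)"
      using t \<theta> by (intro convex_onD[OF pos_powr_convex]) auto
    finally have "node k powr \<theta> * pos_powr (1 + \<theta>) ((1 - t) *\<^sub>R x + t *\<^sub>R y - node k) \<le>
      node k powr \<theta> * ((1 - t) * pos_powr (1 + \<theta>) (x - node k) + t * pos_powr (1 + \<theta>) (y - node k))"
      by (intro mult_left_mono) auto
    then show "node k powr \<theta> * pos_powr (1 + \<theta>) ((1 - t) *\<^sub>R x + t *\<^sub>R y - node k) \<le>
      (1 - t) * (node k powr \<theta> * pos_powr (1 + \<theta>) (x - node k)) +
      t * (node k powr \<theta> * pos_powr (1 + \<theta>) (y - node k))"
      by (simp add: algebra_simps)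
  qed
  also have "\<dots> = (1 - t) * osc \<theta> x + t * osc \<theta> y"
    unfolding osc_def
    by (subst suminf_add[symmetric]) (auto intro!: summable_mult osc_summable simp: suminf_mult osc_summable)
  finally show "osc \<theta> ((1 - t) *\<^sub>R x + t *\<^sub>R y) \<le> (1 - t) * osc \<theta> x + t * osc \<theta> y" .
qed auto

text \<open>Each summand scales by itself, because a dilation by \<open>m \<ge> 1\<close> only helps
  against the fixed shift \<open>node k\<close>. Conditions (B) and (S) and the doubling argument
  all rest on this inequality.\<close>

lemma osc_scale:
  assumes "m \<ge> 1"
  shows "m powr (1 + \<theta>) * osc \<theta> l \<le> osc \<theta> (l * m)"
proof -
  have "m powr (1 + \<theta>) * osc \<theta> l =
      (\<Sum>k. m powr (1 + \<theta>) * (node k powr \<theta> * pos_powr (1 + \<theta>) (l - node k)))"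
    unfolding osc_def by (intro suminf_mult[symmetric] osc_summable)
  also have "\<dots> \<le> osc \<theta> (l * m)"
    unfolding osc_def
  proof (intro suminf_le osc_summable summable_mult)
    fix k
    have "node k powr \<theta> * (m powr (1 + \<theta>) * pos_powr (1 + \<theta>) (l - node k)) \<le>
      node k powr \<theta> * pos_powr (1 + \<theta>) (l * m - node k)"
      using assms \<theta> by (intro mult_left_mono pos_powr_scale) auto
    then show "m powr (1 + \<theta>) * (node k powr \<theta> * pos_powr (1 + \<theta>) (l - node k)) \<le>
      node k powr \<theta> * pos_powr (1 + \<theta>) (l * m - node k)" by (simp add: mult_ac)
  qed
  finally show ?thesis .
qed

lemma osc_measurable [measurable]: "osc \<theta> \<in> borel_measurable borel"
  using convex_on_continuous[OF open_UNIV osc_convex] by (rule borel_measurable_continuous_onI)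

lemma osc_condition_M: "condition_M (osc \<theta>)"
  unfolding condition_M_def
proof (intro conjI allI impI)
  fix u :: real assume "u \<ge> 0"
  have "cball u 1 \<inter> {0..} \<subseteq> {..u + 1}" by (auto simp: dist_real_def)
  then show "\<exists>r>0. \<exists>L. L-lipschitz_on (cball u r \<inter> {0..}) (osc \<theta>)"
    using lipschitz_on_subset[OF convex_mono_lipschitz[OF osc_convex osc_mono osc_nonneg]]
    by (intro exI[of _ 1]) auto
qed (auto intro: mono_onI osc_mono)

lemma set_integrable_powr_minus:
  "set_integrable lborel {1<..} (\<lambda>s :: real. 1 / s powr (1 + \<theta>))"
proof -
  have "(\<lambda>s. s powr (- (1 + \<theta>))) absolutely_integrable_on {1..}"
  proof (rule nonnegative_absolutely_integrable_1)
    show "(\<lambda>s. s powr (- (1 + \<theta>))) integrable_on {1..}"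
      using has_integral_powr_to_inf[of "- (1 + \<theta>)" 1] \<theta> by (auto simp: integrable_on_def)
  qed auto
  then have "set_integrable lebesgue {1..} (\<lambda>s :: real. 1 / s powr (1 + \<theta>))"
    by (simp only: powr_minus_divide)
  then have "set_integrable lborel {1..} (\<lambda>s :: real. 1 / s powr (1 + \<theta>))"
    unfolding set_integrable_def by (subst (asm) integrable_completion) auto
  then show ?thesis by (rule set_integrable_subset) auto
qed

text \<open>The witnesses are \<open>m0 = 1\<close> and \<open>g m = m powr (1 + \<theta>)\<close>,
  as \<open>osc_scale\<close> dictates; the cutoff \<open>c0 = 1\<close> is an arbitrary
  choice.\<close>

lemma osc_condition_S: "condition_S (osc \<theta>)"
  unfolding condition_S_def
proof (intro exI conjI allI impI)
  show "set_integrable lborel {1<..} (\<lambda>s. 1 / s powr (1 + \<theta>))" by (rule set_integrable_powr_minus)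
  show "m powr (1 + \<theta>) * osc \<theta> l \<le> osc \<theta> (l * m)" if "0 < l \<and> 1 \<le> m \<and> l * m \<in> {0<..<1}" for l m
    using that osc_scale by auto
qed auto

lemma osc_one_pos: "osc \<theta> 1 > 0"
proof -
  have "0 < node 0 powr \<theta> * pos_powr (1 + \<theta>) (1 - node 0)" by (simp add: pos_powr_def)
  also have "\<dots> \<le> osc \<theta> 1" by (rule osc_ge)
  finally show ?thesis .
qed

text \<open>Scaling from the point 1 bounds \<open>osc \<theta> u\<close> below by a multiple of
  \<open>u powr (1 + \<theta>)\<close>. The majorant lives on \<open>{1<..}\<close>, and the
  endpoint 1 is a null set.\<close>

lemma osc_condition_B: "condition_B (osc \<theta>)"
proof -
  have "(\<integral>\<^sup>+u\<in>{1..}. 1 / ennreal (osc \<theta> u) \<partial>lborel) \<le>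
    (\<integral>\<^sup>+u. ennreal (inverse (osc \<theta> 1)) * ennreal (indicator {1<..} u * (1 / u powr (1 + \<theta>))) \<partial>lborel)"
  proof (rule nn_integral_mono_AE)
    have "1 / ennreal (osc \<theta> u) \<le> ennreal (inverse (osc \<theta> 1)) * ennreal (1 / u powr (1 + \<theta>))"
      if "u > 1" for u
    proof -
      have "u powr (1 + \<theta>) * osc \<theta> 1 \<le> osc \<theta> u" using osc_scale[of u 1] that by simp
      moreover have "0 < u powr (1 + \<theta>) * osc \<theta> 1" using osc_one_pos that by simp
      ultimately have "1 / osc \<theta> u \<le> 1 / (u powr (1 + \<theta>) * osc \<theta> 1)" and p: "0 < osc \<theta> u"
        by (auto intro!: divide_left_mono mult_pos_pos)
      then have "1 / osc \<theta> u \<le> inverse (osc \<theta> 1) * (1 / u powr (1 + \<theta>))"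
        by (simp add: field_simps)
      then have "ennreal (1 / osc \<theta> u) \<le> ennreal (inverse (osc \<theta> 1) * (1 / u powr (1 + \<theta>)))"
        by (rule ennreal_leI)
      moreover have "1 / ennreal (osc \<theta> u) = ennreal (1 / osc \<theta> u)"
        using p by (metis divide_ennreal ennreal_1 zero_le_one)
      ultimately show ?thesis using osc_one_pos by (simp add: ennreal_mult[symmetric])
    qed
    moreover have "AE u in lborel. u \<noteq> (1 :: real)" by (rule AE_lborel_singleton)
    ultimately show "AE u in lborel. 1 / ennreal (osc \<theta> u) * indicator {1..} u \<le>
      ennreal (inverse (osc \<theta> 1)) * ennreal (indicator {1<..} u * (1 / u powr (1 + \<theta>)))"
      by (auto elim!: eventually_mono split: split_indicator)
  qed
  also have "\<dots> < \<infinity>"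
    using set_integrable_powr_minus unfolding set_integrable_def
    by (subst nn_integral_cmult) (auto simp: ennreal_mult_less_top integrable_iff_bounded abs_mult)
  finally show ?thesis by (simp add: condition_B_def)
qed

text \<open>Terms of index at most k vanish at \<open>node k\<close>. In the tail every truncated
  power is at most \<open>node k powr (1 + \<theta>)\<close>, while the coefficients are dominated
  by a geometric series with first term
  \<open>node (Suc k) powr \<theta> = node k powr (4 * \<theta>)\<close>; the two exponents add up
  to \<open>1 + 5 * \<theta>\<close>.\<close>

lemma osc_node_le:
  "osc \<theta> (node k) \<le> node k powr (1 + 5 * \<theta>) / (1 - (1 / 2) powr \<theta>)"
proof -
  let ?r = "(1 / 2 :: real) powr \<theta>"
  have 1: "(\<lambda>i. node (Suc k + i) powr \<theta> * pos_powr (1 + \<theta>) (node k - node (Suc k + i))) sums osc \<theta> (node k)"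
  proof -
    have "(\<Sum>i<Suc k. node i powr \<theta> * pos_powr (1 + \<theta>) (node k - node i)) = 0"
      using node_antimono[of _ k] by (intro sum.neutral) auto
    moreover have "(\<lambda>i. node i powr \<theta> * pos_powr (1 + \<theta>) (node k - node i)) sums osc \<theta> (node k)"
      unfolding osc_def by (rule summable_sums[OF osc_summable])
    ultimately show ?thesis
      using sums_iff_shift[of "\<lambda>i. node i powr \<theta> * pos_powr (1 + \<theta>) (node k - node i)" "Suc k" "osc \<theta> (node k)"]
      by (simp add: add.commute)
  qed
  have "osc \<theta> (node k) \<le> (\<Sum>i. (node (Suc k) powr \<theta> * ?r ^ i) * node k powr (1 + \<theta>))"
    unfolding sums_unique[OF 1]
  proof (intro suminf_le sums_summable[OF 1] summable_mult2 summable_mult summable_half_powr \<theta>)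
    fix i
    have "pos_powr (1 + \<theta>) (node k - node (Suc k + i)) \<le> pos_powr (1 + \<theta>) (node k)"
      using \<theta> by (intro pos_powr_mono) auto
    also have "\<dots> = node k powr (1 + \<theta>)" by (simp add: pos_powr_def)
    finally show "node (Suc k + i) powr \<theta> * pos_powr (1 + \<theta>) (node k - node (Suc k + i)) \<le>
      (node (Suc k) powr \<theta> * ?r ^ i) * node k powr (1 + \<theta>)"
      by (intro mult_mono node_powr_add_le \<theta>) auto
  qed
  also have "\<dots> = node (Suc k) powr \<theta> * (1 / (1 - ?r)) * node k powr (1 + \<theta>)"
    using half_powr_lt_1[OF \<theta>]
    by (intro sums_unique[symmetric, OF sums_mult2[OF sums_mult[OF geometric_sums]]]) simp
  also have "node (Suc k) powr \<theta> = node k powr (4 * \<theta>)"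
  proof -
    have "node (Suc k) = node k powr 4" by (simp add: node_Suc)
    then show ?thesis by (simp only: powr_powr)
  qed
  also have "node k powr (4 * \<theta>) * (1 / (1 - ?r)) * node k powr (1 + \<theta>) = node k powr (1 + 5 * \<theta>) / (1 - ?r)"
    by (simp add: add.commute flip: powr_add)
  finally show ?thesis .
qed

lemma osc_twice_node_ge: "node k powr (1 + 2 * \<theta>) \<le> osc \<theta> (2 * node k)"
  using osc_ge[of k "2 * node k"] by (simp add: pos_powr_def algebra_simps flip: powr_add)


lemma node_powr_tendsto_0: "e > 0 \<Longrightarrow> (\<lambda>k. node k powr e) \<longlonglongrightarrow> 0"
  using node_tendsto_0 by (rule tendsto_zero_powrI[where b = e]) auto

text \<open>The k-th term alone makes the quotient at least a constant times
  \<open>node k powr (- \<theta>)\<close>. Both blow-up and the divergence of the integral are drawn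
  from this growth.\<close>

lemma osc_twice_node_ratio:
  "filterlim (\<lambda>k. osc \<theta> (2 * node k) / (2 * node k) powr (1 + 3 * \<theta>)) at_top sequentially"
proof (rule filterlim_at_top_mono)
  have "filterlim (\<lambda>k. inverse (node k powr \<theta>)) at_top sequentially"
    using node_powr_tendsto_0[OF \<theta>] by (intro filterlim_inverse_at_top) (auto simp: less_imp_neq[OF node_pos, symmetric])
  then show "filterlim (\<lambda>k. 2 powr - (1 + 3 * \<theta>) * inverse (node k powr \<theta>)) at_top sequentially"
    by (intro filterlim_tendsto_pos_mult_at_top[OF tendsto_const]) auto
  have "2 powr - (1 + 3 * \<theta>) * inverse (node k powr \<theta>) \<le> osc \<theta> (2 * node k) / (2 * node k) powr (1 + 3 * \<theta>)" for k
  proof -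
    have "2 powr - (1 + 3 * \<theta>) * inverse (node k powr \<theta>) = node k powr (1 + 2 * \<theta>) / (2 * node k) powr (1 + 3 * \<theta>)"
    proof -
      have "node k powr (1 + 2 * \<theta>) / node k powr (1 + 3 * \<theta>) = inverse (node k powr \<theta>)"
        by (simp flip: powr_diff powr_minus)
      then show ?thesis
        unfolding powr_mult powr_minus by (simp add: divide_inverse mult.assoc mult.left_commute)
    qed
    also have "\<dots> \<le> osc \<theta> (2 * node k) / (2 * node k) powr (1 + 3 * \<theta>)"
      by (intro divide_right_mono osc_twice_node_ge) auto
    finally show ?thesis .
  qed
  then show "\<forall>\<^sub>F k in sequentially. 2 powr - (1 + 3 * \<theta>) * inverse (node k powr \<theta>) \<le> osc \<theta> (2 * node k) / (2 * node k) powr (1 + 3 * \<theta>)"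
    by simp
qed

lemma osc_node_ratio: "(\<lambda>k. osc \<theta> (node k) / node k powr (1 + 3 * \<theta>)) \<longlonglongrightarrow> 0"
proof (rule tendsto_sandwich[OF _ _ tendsto_const])
  have "(\<lambda>k. node k powr (2 * \<theta>) / (1 - (1 / 2) powr \<theta>)) \<longlonglongrightarrow> 0 / (1 - (1 / 2) powr \<theta>)"
    using \<theta> half_powr_lt_1[OF \<theta>] by (intro tendsto_divide node_powr_tendsto_0 tendsto_const) auto
  then show "(\<lambda>k. node k powr (2 * \<theta>) / (1 - (1 / 2) powr \<theta>)) \<longlonglongrightarrow> 0" by simp
  have "osc \<theta> (node k) / node k powr (1 + 3 * \<theta>) \<le> node k powr (2 * \<theta>) / (1 - (1 / 2) powr \<theta>)" for k
  proof -
    have "osc \<theta> (node k) / node k powr (1 + 3 * \<theta>) \<le>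
      (node k powr (1 + 5 * \<theta>) / (1 - (1 / 2) powr \<theta>)) / node k powr (1 + 3 * \<theta>)"
      by (intro divide_right_mono osc_node_le) auto
    also have "\<dots> = (node k powr (1 + 5 * \<theta>) / node k powr (1 + 3 * \<theta>)) / (1 - (1 / 2) powr \<theta>)"
      by simp
    also have "\<dots> = node k powr (2 * \<theta>) / (1 - (1 / 2) powr \<theta>)"
      by (simp flip: powr_diff)
    finally show ?thesis .
  qed
  then show "\<forall>\<^sub>F k in sequentially. osc \<theta> (node k) / node k powr (1 + 3 * \<theta>) \<le> node k powr (2 * \<theta>) / (1 - (1 / 2) powr \<theta>)"
    by simp
qed auto

text \<open>With l the square root of \<open>node k\<close>, the distance l - l^2 from the node is
  still a fixed fraction of l, and the coefficient \<open>node k powr \<theta>\<close> equals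
  \<open>l powr (2 * \<theta>)\<close>. The exponents \<open>2 * \<theta>\<close> and
  \<open>1 + \<theta>\<close> add up to the critical one.\<close>

lemma osc_sqrt_node_ge:
  "(1 / 4) powr (1 + \<theta>) * sqrt (node k) powr (1 + 3 * \<theta>) \<le> osc \<theta> (sqrt (node k))"
proof -
  define l where "l = sqrt (node k)"
  have l: "l > 0" "node k = l * l" by (auto simp: l_def)
  \<comment> \<open>A rational bound for the square root of 1/2, the largest value of l; it leaves 1
    - l \<ge> 1/4.\<close>
  have "l \<le> 3 / 4"
    unfolding l_def using node_le_half[of k] by (intro real_le_lsqrt) (auto simp: power2_eq_square)
  then have "l * l \<le> 3 / 4 * l" using l by (intro mult_right_mono) auto
  then have "1 / 4 * l \<le> l - node k" using l by simp
  then have "(1 / 4 * l) powr (1 + \<theta>) \<le> (l - node k) powr (1 + \<theta>)"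
    using l \<theta> by (intro powr_mono2) auto
  also have "\<dots> = pos_powr (1 + \<theta>) (l - node k)"
    using \<open>1 / 4 * l \<le> l - node k\<close> l by (simp add: pos_powr_def)
  finally have "node k powr \<theta> * (1 / 4 * l) powr (1 + \<theta>) \<le> node k powr \<theta> * pos_powr (1 + \<theta>) (l - node k)"
    by (intro mult_left_mono) auto
  also have "\<dots> \<le> osc \<theta> l" by (rule osc_ge)
  also have "node k powr \<theta> * (1 / 4 * l) powr (1 + \<theta>) = (1 / 4) powr (1 + \<theta>) * l powr (1 + 3 * \<theta>)"
    using l by (simp add: powr_mult powr_add[symmetric] powr_divide add.commute)
  finally show ?thesis by (simp add: l_def)
qed

text \<open>In terms of l the numerator has order at most \<open>l powr (2 + 10 * \<theta>)\<close>
  and the denominator at least \<open>l powr (2 + 6 * \<theta>)\<close>. What remains is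
  \<open>l powr (4 * \<theta>) = node k powr (2 * \<theta>)\<close>.\<close>

lemma osc_sqrt_node_ratio:
  "(\<lambda>k. osc \<theta> ((sqrt (node k))\<^sup>2) / (sqrt (node k) powr (1 + 3 * \<theta>) * osc \<theta> (sqrt (node k)))) \<longlonglongrightarrow> 0"
proof (rule tendsto_sandwich[OF _ _ tendsto_const])
  let ?C = "4 powr (1 + \<theta>) / (1 - (1 / 2) powr \<theta>)"
  have "(\<lambda>k. ?C * node k powr (2 * \<theta>)) \<longlonglongrightarrow> ?C * 0"
    using \<theta> by (intro tendsto_mult node_powr_tendsto_0 tendsto_const) auto
  then show "(\<lambda>k. ?C * node k powr (2 * \<theta>)) \<longlonglongrightarrow> 0" by simp
  have "osc \<theta> ((sqrt (node k))\<^sup>2) / (sqrt (node k) powr (1 + 3 * \<theta>) * osc \<theta> (sqrt (node k))) \<le> ?C * node k powr (2 * \<theta>)" for k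
  proof -
    define l where "l = sqrt (node k)"
    have l: "l > 0" "node k = l powr 2" by (auto simp: l_def)
    have "osc \<theta> (l\<^sup>2) / (l powr (1 + 3 * \<theta>) * osc \<theta> l) \<le>
      (l powr (2 + 10 * \<theta>) / (1 - (1 / 2) powr \<theta>)) / (l powr (1 + 3 * \<theta>) * ((1 / 4) powr (1 + \<theta>) * l powr (1 + 3 * \<theta>)))"
    proof (rule frac_le)
      have "osc \<theta> (l\<^sup>2) = osc \<theta> (node k)" by (simp add: l_def)
      also have "\<dots> \<le> node k powr (1 + 5 * \<theta>) / (1 - (1 / 2) powr \<theta>)" by (rule osc_node_le)
      also have "node k powr (1 + 5 * \<theta>) = l powr (2 + 10 * \<theta>)" unfolding l(2) powr_powr by simp
      finally show "osc \<theta> (l\<^sup>2) \<le> l powr (2 + 10 * \<theta>) / (1 - (1 / 2) powr \<theta>)" .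
      show "l powr (1 + 3 * \<theta>) * ((1 / 4) powr (1 + \<theta>) * l powr (1 + 3 * \<theta>)) \<le> l powr (1 + 3 * \<theta>) * osc \<theta> l"
        unfolding l_def by (intro mult_left_mono osc_sqrt_node_ge) auto
    qed (use l half_powr_lt_1[OF \<theta>] in auto)
    also have "\<dots> = ?C * (l powr (2 + 10 * \<theta>) / (l powr (1 + 3 * \<theta>) * l powr (1 + 3 * \<theta>)))"
      by (simp add: powr_divide)
    also have "l powr (2 + 10 * \<theta>) / (l powr (1 + 3 * \<theta>) * l powr (1 + 3 * \<theta>)) = node k powr (2 * \<theta>)"
      unfolding l(2) powr_powr by (simp flip: powr_add powr_diff)
    finally show ?thesis by (simp add: l_def)
  qed
  then show "\<forall>\<^sub>F k in sequentially. osc \<theta> ((sqrt (node k))\<^sup>2) / (sqrt (node k) powr (1 + 3 * \<theta>) * osc \<theta> (sqrt (node k))) \<le> ?C * node k powr (2 * \<theta>)"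
    by simp
qed auto

text \<open>No summation over nodes takes place. With \<open>a = 2 * node k\<close>, the interval
  from a to 2 * a alone contributes at least a fixed multiple of the quotient at a, by monotonicity
  of \<open>osc \<theta>\<close>, and that quotient is unbounded in k.\<close>

lemma osc_integral_diverges:
  assumes "\<delta> > 0"
  shows "(\<integral>\<^sup>+u\<in>{0<..<\<delta>}. ennreal (osc \<theta> u / u powr (2 + 3 * \<theta>)) \<partial>lborel) = \<infinity>" (is "?I = \<infinity>")
proof (rule ccontr)
  assume "?I \<noteq> \<infinity>"
  then obtain B where B: "?I = ennreal B" "B \<ge> 0" by (cases ?I) auto
  let ?h = "\<lambda>k. osc \<theta> (2 * node k) / (2 * node k) powr (1 + 3 * \<theta>)"
  have "(\<lambda>k. 4 * node k) \<longlonglongrightarrow> 4 * 0" by (intro tendsto_mult tendsto_const node_tendsto_0)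
  then have "\<forall>\<^sub>F k in sequentially. 4 * node k < \<delta>"
    using assms order_tendstoD(2)[of "\<lambda>k. 4 * node k" "4 * 0" sequentially \<delta>] by simp
  moreover have "\<forall>\<^sub>F k in sequentially. B * 2 powr (2 + 3 * \<theta>) < ?h k"
    using osc_twice_node_ratio by (simp add: filterlim_at_top_dense)
  ultimately have "\<forall>\<^sub>F k in sequentially. 4 * node k < \<delta> \<and> B * 2 powr (2 + 3 * \<theta>) < ?h k"
    by eventually_elim auto
  then obtain k where k: "4 * node k < \<delta>" "B * 2 powr (2 + 3 * \<theta>) < ?h k"
    by (auto dest: eventually_happens)
  define a where "a = 2 * node k"
  have a: "a > 0" "2 * a < \<delta>" using k by (auto simp: a_def)
  let ?c = "osc \<theta> a / (2 * a) powr (2 + 3 * \<theta>)"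
  have "ennreal (?c * a) = (\<integral>\<^sup>+u. ennreal ?c * indicator {a<..<2*a} u \<partial>lborel)"
    using a ennreal_mult''[of a ?c] by (subst nn_integral_cmult_indicator) auto
  also have "\<dots> \<le> ?I"
  proof (intro nn_integral_mono)
    fix u
    have "?c \<le> osc \<theta> u / u powr (2 + 3 * \<theta>)" if "a < u" "u < 2 * a"
      using that a \<theta> by (intro frac_le osc_mono powr_mono2) auto
    then show "ennreal ?c * indicator {a<..<2*a} u \<le> ennreal (osc \<theta> u / u powr (2 + 3 * \<theta>)) * indicator {0<..<\<delta>} u"
      using a by (auto split: split_indicator intro: ennreal_leI)
  qed
  finally have "?c * a \<le> B" using B by simp
  moreover have "?c * a = ?h k / 2 powr (2 + 3 * \<theta>)"
  proof -
    have "a powr (2 + 3 * \<theta>) = a powr (1 + (1 + 3 * \<theta>))" by simp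
    also have "\<dots> = a * a powr (1 + 3 * \<theta>)" unfolding powr_add using a by simp
    finally have "(2 * a) powr (2 + 3 * \<theta>) = 2 powr (2 + 3 * \<theta>) * (a * a powr (1 + 3 * \<theta>))"
      by (simp add: powr_mult)
    then show ?thesis unfolding a_def[symmetric] using a by simp
  qed
  ultimately have "?h k / 2 powr (2 + 3 * \<theta>) \<le> B" by simp
  then have "?h k \<le> B * 2 powr (2 + 3 * \<theta>)" by (subst (asm) pos_divide_le_eq) auto
  then show False using k(2) by simp
qed

end

lemma Liminf_at_right_0_eq_0:
  fixes F :: "real \<Rightarrow> real"
  assumes "\<And>u. u > 0 \<Longrightarrow> 0 \<le> F u" and x: "\<And>k. x k > 0" "x \<longlonglongrightarrow> 0" and F: "(\<lambda>k. F (x k)) \<longlonglongrightarrow> 0"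
  shows "Liminf (at_right 0) (\<lambda>u. ereal (F u)) = 0"
proof (rule antisym)
  have flt: "filterlim x (at_right 0) sequentially"
    using x by (auto simp: filterlim_at less_imp_neq[OF x(1), symmetric] intro!: always_eventually)
  show "Liminf (at_right 0) (\<lambda>u. ereal (F u)) \<le> 0"
  proof (rule ccontr)
    assume "\<not> ?thesis"
    then obtain e where e: "0 < ereal e" "ereal e < Liminf (at_right 0) (\<lambda>u. ereal (F u))"
      using ereal_dense2[of 0] by (auto simp: not_le)
    have "\<forall>\<^sub>F u in at_right 0. ereal e < ereal (F u)" using e(2) by (rule less_LiminfD)
    then have "\<forall>\<^sub>F k in sequentially. e < F (x k)"
      using flt by (auto simp: filterlim_iff)
    moreover have "\<forall>\<^sub>F k in sequentially. F (x k) < e"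
      using order_tendstoD(2)[OF F, of e] e by simp
    ultimately have "\<forall>\<^sub>F k in sequentially. False" by eventually_elim auto
    then show False by simp
  qed
  show "0 \<le> Liminf (at_right 0) (\<lambda>u. ereal (F u))"
    using assms(1) by (intro Liminf_bounded) (auto simp: eventually_at_right_field intro: exI[of _ 1])
qed

section \<open>Fourier transforms of Gaussians\<close>

lemma borel_measurable_cis [measurable]: "cis \<in> borel_measurable borel"
  by (intro borel_measurable_continuous_onI continuous_intros)

lemma integrable_cis_mult:
  fixes f :: "'a::euclidean_space \<Rightarrow> complex"
  assumes "integrable lborel f" "g \<in> borel_measurable borel"
  shows "integrable lborel (\<lambda>x. cis (g x) * f x)"
  using assms by (intro Bochner_Integration.integrable_bound[OF assms(1)]) (auto simp: norm_mult)

text \<open>The Fourier integral with positive sign and without normalising factor. Complex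
  arguments allow characters to be absorbed into f, which expresses translations and
  modulations.\<close>

definition fourier_plus :: "('a::euclidean_space \<Rightarrow> complex) \<Rightarrow> 'a \<Rightarrow> complex" where
  "fourier_plus f x = (LINT \<xi>|lborel. cis (x \<bullet> \<xi>) * f \<xi>)"

lemma norm_fourier_plus_le:
  assumes "integrable lborel f"
  shows "norm (fourier_plus f x) \<le> (LINT \<xi>|lborel. norm (f \<xi>))"
  unfolding fourier_plus_def
  by (rule order_trans[OF integral_norm_bound]) (simp add: norm_mult)

lemma continuous_fourier_plus:
  assumes f: "integrable lborel f"
  shows "continuous_on UNIV (fourier_plus f)"
proof (clarsimp simp: continuous_on_sequentially comp_def)
  fix X and x :: 'a assume X: "X \<longlonglongrightarrow> x"
  have [measurable]: "f \<in> borel_measurable borel" using f by auto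
  show "(\<lambda>n. fourier_plus f (X n)) \<longlonglongrightarrow> fourier_plus f x"
    unfolding fourier_plus_def
  proof (rule integral_dominated_convergence[where w = "\<lambda>\<xi>. norm (f \<xi>)"])
    show "AE \<xi> in lborel. (\<lambda>n. cis (X n \<bullet> \<xi>) * f \<xi>) \<longlonglongrightarrow> cis (x \<bullet> \<xi>) * f \<xi>"
      by (intro AE_I2 tendsto_intros isCont_tendsto_compose[OF _ tendsto_inner[OF X tendsto_const]]) 
         (auto intro: continuous_intros)
  qed (use f in \<open>auto simp: norm_mult\<close>)
qed

text \<open>Fubini's theorem for the symmetric factor \<open>cis (x \<bullet> \<xi>)\<close>: the
  multiplication formula. With a Gaussian as g it takes the place of Fourier inversion.\<close>

lemma fourier_plus_swap:
  fixes f g :: "'a::euclidean_space \<Rightarrow> complex"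
  assumes f: "integrable lborel f" and g: "integrable lborel g"
  shows "(LINT x|lborel. fourier_plus f x * g x) = (LINT \<xi>|lborel. f \<xi> * fourier_plus g \<xi>)"
proof -
  have [measurable]: "f \<in> borel_measurable borel" "g \<in> borel_measurable borel" using f g by auto
  let ?h = "\<lambda>x \<xi>. cis (x \<bullet> \<xi>) * f \<xi> * g x"
  have "integrable (lborel \<Otimes>\<^sub>M lborel) (case_prod ?h)"
  proof (rule lborel_pair.Fubini_integrable)
    show "AE x in lborel. integrable lborel (\<lambda>\<xi>. case_prod ?h (x, \<xi>))"
      using f by (auto intro!: integrable_mult_left integrable_cis_mult)
    show "integrable lborel (\<lambda>x. LINT \<xi>|lborel. norm (case_prod ?h (x, \<xi>)))"
      using f g by (auto simp: norm_mult intro!: integrable_mult_right)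
  qed measurable
  from lborel_pair.Fubini_integral[OF this]
  have "(LINT \<xi>|lborel. LINT x|lborel. ?h x \<xi>) = (LINT x|lborel. LINT \<xi>|lborel. ?h x \<xi>)" by simp
  moreover have "(LINT x|lborel. ?h x \<xi>) = f \<xi> * fourier_plus g \<xi>" for \<xi>
    unfolding fourier_plus_def
    by (subst integral_mult_right_zero[symmetric]) (auto simp: inner_commute mult_ac intro!: Bochner_Integration.integral_cong)
  moreover have "(LINT \<xi>|lborel. ?h x \<xi>) = fourier_plus f x * g x" for x
    unfolding fourier_plus_def by (rule integral_mult_left_zero)
  ultimately show ?thesis by (simp only:)
qed

lemma
  fixes g :: "'a::euclidean_space \<Rightarrow> real \<Rightarrow> 'b::{real_normed_field,banach,second_countable_topology}"
  assumes g: "\<And>b. b \<in> Basis \<Longrightarrow> integrable lborel (g b)"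
  shows integrable_lborel_prod_Basis: "integrable lborel (\<lambda>x. \<Prod>b\<in>Basis. g b (x \<bullet> b))" (is ?A)
    and integral_lborel_prod_Basis:
      "(LINT x|lborel. (\<Prod>b\<in>Basis. g b (x \<bullet> b))) = (\<Prod>b\<in>Basis. (LINT s|lborel. g b s))" (is ?B)
proof -
  have [measurable]: "b \<in> Basis \<Longrightarrow> g b \<in> borel_measurable borel" for b using g[of b] by auto
  interpret P: product_sigma_finite "\<lambda>_::'a. lborel :: real measure" by standard
  have *: "(\<Prod>b\<in>Basis. g b ((\<Sum>c\<in>Basis. f c *\<^sub>R c) \<bullet> b)) = (\<Prod>b\<in>Basis. g b (f b))" for f
    by (intro prod.cong refl) (simp add: inner_sum_left inner_Basis if_distrib cong: if_cong)
  have m: "(\<lambda>f. \<Sum>b\<in>Basis. f b *\<^sub>R b :: 'a) \<in> (\<Pi>\<^sub>M b\<in>Basis. lborel) \<rightarrow>\<^sub>M borel" by measurable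
  have m': "(\<lambda>x. \<Prod>b\<in>Basis. g b (x \<bullet> b)) \<in> borel_measurable borel" by measurable
  show ?A
    by (subst lborel_eq, subst integrable_distr_eq[OF m m']) (simp add: * P.product_integrable_prod g)
  show ?B
    by (subst lborel_eq, subst integral_distr[OF m m']) (simp add: * P.product_integral_prod g)
qed

lemma integral_lborel_affine:
  fixes F :: "'a::euclidean_space \<Rightarrow> 'b::{banach, second_countable_topology}"
  assumes [measurable]: "F \<in> borel_measurable borel" and c: "c \<noteq> 0"
  shows "(LINT x|lborel. F x) = \<bar>c\<bar> ^ DIM('a) *\<^sub>R (LINT x|lborel. F (t + c *\<^sub>R x))"
proof -
  have "(LINT x|lborel. F x) = (LINT x|density (distr lborel borel (\<lambda>x. t + c *\<^sub>R x)) (\<lambda>_. ennreal (\<bar>c\<bar> ^ DIM('a))). F x)"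
    using lborel_affine[OF c, of t] by simp
  also have "\<dots> = (LINT x|lborel. \<bar>c\<bar> ^ DIM('a) *\<^sub>R F (t + c *\<^sub>R x))"
    by (subst integral_density) (auto simp: integral_distr)
  finally show ?thesis by simp
qed

lemma integrable_lborel_affine:
  fixes F :: "'a::euclidean_space \<Rightarrow> 'b::{banach, second_countable_topology}"
  assumes F: "integrable lborel F" and c: "c \<noteq> 0"
  shows "integrable lborel (\<lambda>x. F (t + c *\<^sub>R x))"
proof -
  have [measurable]: "F \<in> borel_measurable borel" using F by auto
  have "integrable (density (distr lborel borel (\<lambda>x. t + c *\<^sub>R x)) (\<lambda>_. ennreal (\<bar>c\<bar> ^ DIM('a)))) F"
    using lborel_affine[OF c, of t] F by simp
  then have "integrable lborel (\<lambda>x. \<bar>c\<bar> ^ DIM('a) *\<^sub>R F (t + c *\<^sub>R x))"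
    by (subst (asm) integrable_density) (auto simp: integrable_distr_eq)
  from integrable_scaleR_right[OF this, of "inverse (\<bar>c\<bar> ^ DIM('a))"]
  show ?thesis using c by simp
qed

text \<open>The exponential beats the polynomial (1 + |\<xi>|^2)^n, with n the dimension, and this
  polynomial dominates the product of the 1 + \<xi>_b^2 over the coordinates. A multiple of a
  product of integrable one-dimensional functions is thus a majorant.\<close>

lemma integrable_exp_powr:
  assumes t: "t > 0" and \<alpha>: "\<alpha> > 0"
  shows "integrable lborel (\<lambda>\<xi>::'a::euclidean_space. exp (- t * norm \<xi> powr \<alpha>))"
proof -
  let ?N = "DIM('a)"
  let ?h = "\<lambda>r::real. (1 + r\<^sup>2) ^ ?N * exp (- t * r powr \<alpha>)"
  have "(?h \<longlongrightarrow> 0) at_top" using t \<alpha> by real_asymp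
  then have "\<forall>\<^sub>F r in at_top. ?h r < 1" by (rule order_tendstoD) simp
  then obtain R where R: "\<And>r. r \<ge> R \<Longrightarrow> ?h r < 1" by (auto simp: eventually_at_top_linorder)
  define B where "B = (1 + R\<^sup>2) ^ ?N + 1"
  have B: "?h r \<le> B" if "r \<ge> 0" for r
  proof (cases "r \<ge> R")
    case True
    have "0 \<le> (1 + R\<^sup>2) ^ ?N" by simp
    then show ?thesis using R[OF True] unfolding B_def by linarith
  next
    case False
    have "?h r \<le> (1 + r\<^sup>2) ^ ?N * 1" using t by (intro mult_left_mono) auto
    also have "\<dots> \<le> (1 + R\<^sup>2) ^ ?N * 1" using False that by (intro mult_right_mono power_mono add_mono) auto
    finally show ?thesis by (simp add: B_def)
  qed
  have "integrable lborel (\<lambda>s::real. inverse (1 + s\<^sup>2))"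
    using integrable_inverse_1_plus_square by (simp add: set_integrable_def)
  then have int: "integrable lborel (\<lambda>\<xi>::'a. B * (\<Prod>b\<in>Basis. inverse (1 + (\<xi> \<bullet> b)\<^sup>2)))"
    by (intro integrable_mult_right integrable_lborel_prod_Basis)
  show ?thesis
  proof (rule Bochner_Integration.integrable_bound[OF int])
    show "AE \<xi> in lborel. norm (exp (- t * norm (\<xi>::'a) powr \<alpha>)) \<le> norm (B * (\<Prod>b\<in>Basis. inverse (1 + (\<xi> \<bullet> b)\<^sup>2)))"
    proof (intro AE_I2)
      fix \<xi> :: 'a
      have p: "0 < (\<Prod>b\<in>Basis. (1 + (\<xi> \<bullet> b)\<^sup>2))" by (intro prod_pos) (auto intro: add_pos_nonneg)
      have "(\<Prod>b\<in>Basis. (1 + (\<xi> \<bullet> b)\<^sup>2)) \<le> (\<Prod>b\<in>(Basis::'a set). (1 + (norm \<xi>)\<^sup>2))"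
        using Basis_le_norm by (intro prod_mono conjI add_mono) (auto simp: abs_le_square_iff[symmetric])
      then have "(\<Prod>b\<in>Basis. (1 + (\<xi> \<bullet> b)\<^sup>2)) * exp (- t * norm \<xi> powr \<alpha>) \<le> ?h (norm \<xi>)"
        by (intro mult_right_mono) auto
      also have "\<dots> \<le> B" by (rule B) simp
      finally have "exp (- t * norm \<xi> powr \<alpha>) \<le> B * inverse (\<Prod>b\<in>Basis. (1 + (\<xi> \<bullet> b)\<^sup>2))"
        using p by (simp add: field_simps)
      also have "\<dots> = B * (\<Prod>b\<in>Basis. inverse (1 + (\<xi> \<bullet> b)\<^sup>2))" by (simp add: prod_inversef[symmetric] comp_def)
      finally show "norm (exp (- t * norm (\<xi>::'a) powr \<alpha>)) \<le> norm (B * (\<Prod>b\<in>Basis. inverse (1 + (\<xi> \<bullet> b)\<^sup>2)))"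
        by simp
    qed
  qed measurable
qed

section \<open>Gaussians, their transforms and approximate identities\<close>

definition gauss :: "real \<Rightarrow> 'a::euclidean_space \<Rightarrow> real" where
  "gauss \<delta> x = exp (- \<delta> * (norm x)\<^sup>2 / 2)"

text \<open>The transform of \<open>gauss \<delta>\<close>. For positive \<delta> it has total mass
  \<open>(2 * pi) ^ DIM('a)\<close>, and it concentrates at 0 on the scale
  \<open>sqrt \<delta>\<close> as \<delta> tends to 0, while \<open>gauss \<delta>\<close> itself
  tends to 1.\<close>

definition gauss_hat :: "real \<Rightarrow> 'a::euclidean_space \<Rightarrow> real" where
  "gauss_hat \<delta> x = sqrt (2 * pi / \<delta>) ^ DIM('a) * exp (- (norm x)\<^sup>2 / (2 * \<delta>))"

lemma gauss_nonneg [simp]: "0 \<le> gauss \<delta> x" "0 < gauss \<delta> x" and gauss_hat_nonneg [simp]: "\<delta> > 0 \<Longrightarrow> 0 \<le> gauss_hat \<delta> x"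
  by (simp_all add: gauss_def gauss_hat_def)

lemma gauss_measurable [measurable]: "gauss \<delta> \<in> borel_measurable borel" "gauss_hat \<delta> \<in> borel_measurable borel"
  unfolding gauss_def gauss_hat_def by measurable

lemma gauss_le_1: "\<delta> \<ge> 0 \<Longrightarrow> gauss \<delta> x \<le> 1"
  by (simp add: gauss_def)

lemma gauss_integrable: "\<delta> > 0 \<Longrightarrow> integrable lborel (gauss \<delta> :: 'a::euclidean_space \<Rightarrow> real)"
  using integrable_exp_powr[of "\<delta> / 2" 2, where 'a = 'a] by (simp add: gauss_def[abs_def])

lemma gauss_hat_integrable: "\<delta> > 0 \<Longrightarrow> integrable lborel (gauss_hat \<delta> :: 'a::euclidean_space \<Rightarrow> real)"
  using gauss_integrable[of "1 / \<delta>", where 'a = 'a] by (simp add: gauss_def[abs_def] gauss_hat_def[abs_def] mult.commute)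

lemma norm_sq_eq_sum_Basis: "(norm x)\<^sup>2 = (\<Sum>b\<in>Basis. (x \<bullet> b)\<^sup>2)"
  unfolding power2_norm_eq_inner euclidean_inner[of x x] by (simp add: power2_eq_square)

text \<open>Rescaling by \<open>sqrt \<delta>\<close> reduces the integral to the characteristic
  function of the standard normal distribution.\<close>

lemma fourier_gauss_real:
  assumes "\<delta> > 0"
  shows "integrable lborel (\<lambda>s::real. cis (x * s) * of_real (exp (- \<delta> * s\<^sup>2 / 2)))" (is ?A)
    and "(LINT s|lborel. cis (x * s) * of_real (exp (- \<delta> * s\<^sup>2 / 2))) =
      of_real (sqrt (2 * pi / \<delta>) * exp (- x\<^sup>2 / (2 * \<delta>)))" (is ?B)
proof -
  have "integrable lborel (\<lambda>s::real. exp (- \<delta> * s\<^sup>2 / 2))"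
    using gauss_integrable[OF assms, where 'a = real] by (simp add: gauss_def[abs_def])
  then show ?A by (intro integrable_cis_mult integrable_of_real) auto
  let ?y = "x / sqrt \<delta>"
  have "complex_of_real (exp (- (?y\<^sup>2) / 2)) = char std_normal_distribution ?y"
    by (simp add: char_std_normal_distribution)
  also have "\<dots> = (LINT s|lborel. std_normal_density s *\<^sub>R iexp (?y * s))"
    unfolding char_def by (subst integral_density) auto
  also have "\<dots> = (LINT s|lborel. of_real (1 / sqrt (2 * pi)) * (cis (?y * s) * of_real (exp (- s\<^sup>2 / 2))))"
    by (intro Bochner_Integration.integral_cong refl)
       (simp add: std_normal_density_def scaleR_conv_of_real cis_conv_exp mult_ac)
  also have "\<dots> = of_real (1 / sqrt (2 * pi)) * (LINT s|lborel. cis (?y * s) * of_real (exp (- s\<^sup>2 / 2)))"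
    by (rule integral_mult_right_zero)
  also have "(LINT s|lborel. cis (?y * s) * of_real (exp (- s\<^sup>2 / 2))) =
    of_real (sqrt \<delta>) * (LINT s|lborel. cis (x * s) * of_real (exp (- \<delta> * s\<^sup>2 / 2)))"
    by (subst integral_lborel_affine[of _ "sqrt \<delta>" 0])
       (use assms in \<open>auto simp: scaleR_conv_of_real power_mult_distrib\<close>)
  finally have "of_real (sqrt \<delta>) * (LINT s|lborel. cis (x * s) * of_real (exp (- \<delta> * s\<^sup>2 / 2))) =
      of_real (sqrt (2 * pi)) * complex_of_real (exp (- (?y\<^sup>2) / 2))"
    by (simp add: field_simps)
  then have "(LINT s|lborel. cis (x * s) * of_real (exp (- \<delta> * s\<^sup>2 / 2))) =
      of_real (sqrt (2 * pi) / sqrt \<delta> * exp (- (?y\<^sup>2) / 2))"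
    using assms by (simp add: field_simps)
  then show ?B using assms by (simp add: real_sqrt_divide power_divide)
qed

lemma fourier_gauss:
  assumes "\<delta> > 0"
  shows "fourier_plus (\<lambda>\<xi>. of_real (gauss \<delta> \<xi>)) x = of_real (gauss_hat \<delta> (x::'a::euclidean_space))"
proof -
  have *: "cis (x \<bullet> \<xi>) * of_real (gauss \<delta> \<xi>) =
      (\<Prod>b\<in>Basis. cis ((x \<bullet> b) * (\<xi> \<bullet> b)) * of_real (exp (- \<delta> * (\<xi> \<bullet> b)\<^sup>2 / 2)))" for \<xi> :: 'a
  proof -
    have "cis (x \<bullet> \<xi>) = (\<Prod>b\<in>Basis. cis ((x \<bullet> b) * (\<xi> \<bullet> b)))"
      unfolding euclidean_inner[of x \<xi>] by (simp add: cis_conv_exp sum_distrib_left exp_sum)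
    moreover have "gauss \<delta> \<xi> = (\<Prod>b\<in>Basis. exp (- \<delta> * (\<xi> \<bullet> b)\<^sup>2 / 2))"
      unfolding gauss_def norm_sq_eq_sum_Basis
      by (simp add: exp_sum[symmetric] sum_distrib_left sum_divide_distrib sum_negf)
    ultimately show ?thesis by (simp add: prod.distrib)
  qed
  show ?thesis
    unfolding fourier_plus_def *
    by (subst integral_lborel_prod_Basis, rule fourier_gauss_real[OF assms], subst fourier_gauss_real[OF assms])
       (simp add: gauss_hat_def norm_sq_eq_sum_Basis[of x] prod.distrib exp_sum[symmetric] sum_divide_distrib sum_negf
             flip: of_real_prod)
qed

lemma fourier_gauss_shift:
  assumes "\<delta> > 0"
  shows "fourier_plus (\<lambda>x. cis (- (x \<bullet> \<eta>)) * of_real (gauss \<delta> x)) \<xi> = of_real (gauss_hat \<delta> (\<xi> - \<eta>))"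
  unfolding fourier_gauss[OF assms, symmetric] fourier_plus_def
  by (intro Bochner_Integration.integral_cong refl)
     (simp add: mult.assoc[symmetric] cis_mult inner_diff_left inner_diff_right inner_commute)

lemma gauss_hat_integral:
  "(LINT \<xi>|lborel. gauss_hat 1 (\<xi>::'a::euclidean_space)) = (2 * pi) ^ DIM('a)"
proof -
  have "complex_of_real (LINT \<xi>|lborel. gauss_hat 1 (\<xi>::'a)) =
      (LINT \<xi>|lborel. of_real (sqrt (2 * pi) ^ DIM('a)) * (cis (0 \<bullet> (\<xi>::'a)) * of_real (gauss 1 \<xi>)))"
    unfolding integral_complex_of_real[symmetric] gauss_hat_def gauss_def by simp
  also have "\<dots> = of_real (sqrt (2 * pi) ^ DIM('a)) * fourier_plus (\<lambda>\<xi>. of_real (gauss 1 \<xi>)) (0::'a)"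
    unfolding fourier_plus_def by (rule integral_mult_right_zero)
  also have "\<dots> = of_real (sqrt (2 * pi) ^ DIM('a) * sqrt (2 * pi) ^ DIM('a))"
    by (subst fourier_gauss) (auto simp: gauss_hat_def)
  also have "sqrt (2 * pi) ^ DIM('a) * sqrt (2 * pi) ^ DIM('a) = (2 * pi) ^ DIM('a)"
    by (subst power_mult_distrib[symmetric]) simp
  finally show ?thesis by (simp only: of_real_eq_iff)
qed

text \<open>Substituting \<xi> = \<eta> + sqrt(d k) z turns the moving Gaussian into the fixed
  weight \<open>gauss_hat 1\<close>; the bound on \<psi> then permits dominated convergence.\<close>

lemma gauss_hat_approx:
  fixes \<psi> :: "'a::euclidean_space \<Rightarrow> complex"
  assumes [measurable]: "\<psi> \<in> borel_measurable borel" and bdd: "\<And>\<xi>. norm (\<psi> \<xi>) \<le> B"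
    and cont: "isCont \<psi> \<eta>" and d: "\<And>k. d k > 0" "d \<longlonglongrightarrow> 0"
  shows "(\<lambda>k. LINT \<xi>|lborel. \<psi> \<xi> * of_real (gauss_hat (d k) (\<xi> - \<eta>))) \<longlonglongrightarrow> of_real ((2 * pi) ^ DIM('a)) * \<psi> \<eta>"
proof -
  have "(LINT \<xi>|lborel. \<psi> \<xi> * of_real (gauss_hat (d k) (\<xi> - \<eta>))) =
      (LINT z|lborel. \<psi> (\<eta> + sqrt (d k) *\<^sub>R z) * of_real (gauss_hat 1 z))" for k
  proof -
    have *: "sqrt (d k) ^ DIM('a) * gauss_hat (d k) (sqrt (d k) *\<^sub>R z) = gauss_hat 1 z" for z :: 'a
      using d(1)[of k]
      by (simp add: gauss_hat_def power_mult_distrib real_sqrt_divide power_divide)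
    have "(LINT \<xi>|lborel. \<psi> \<xi> * of_real (gauss_hat (d k) (\<xi> - \<eta>))) =
      (LINT z|lborel. \<psi> (\<eta> + sqrt (d k) *\<^sub>R z) * of_real (sqrt (d k) ^ DIM('a) * gauss_hat (d k) (sqrt (d k) *\<^sub>R z)))"
      using d(1)[of k]
      by (subst integral_lborel_affine[of _ "sqrt (d k)" \<eta>])
         (auto simp: scaleR_conv_of_real mult_ac simp flip: integral_mult_right_zero)
    then show ?thesis unfolding * .
  qed
  moreover have "(\<lambda>k. LINT z|lborel. \<psi> (\<eta> + sqrt (d k) *\<^sub>R z) * of_real (gauss_hat 1 z)) \<longlonglongrightarrow>
      (LINT z|lborel. \<psi> \<eta> * of_real (gauss_hat 1 (z :: 'a)))"
  proof (rule integral_dominated_convergence[where w = "\<lambda>z. B * gauss_hat 1 z"])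
    show "AE z in lborel. (\<lambda>k. \<psi> (\<eta> + sqrt (d k) *\<^sub>R z) * of_real (gauss_hat 1 z)) \<longlonglongrightarrow> \<psi> \<eta> * of_real (gauss_hat 1 z)"
    proof (intro AE_I2 tendsto_mult tendsto_const isCont_tendsto_compose[OF cont])
      fix z :: 'a
      have "(\<lambda>k. \<eta> + sqrt (d k) *\<^sub>R z) \<longlonglongrightarrow> \<eta> + sqrt 0 *\<^sub>R z" by (intro tendsto_intros d)
      then show "(\<lambda>k. \<eta> + sqrt (d k) *\<^sub>R z) \<longlonglongrightarrow> \<eta>" by simp
    qed
    show "integrable lborel (\<lambda>z::'a. B * gauss_hat 1 z)" by (intro integrable_mult_right gauss_hat_integrable) auto
  qed (use bdd in \<open>auto simp: norm_mult intro!: mult_right_mono\<close>)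
  moreover have "(LINT z|lborel. \<psi> \<eta> * of_real (gauss_hat 1 (z :: 'a))) = of_real ((2 * pi) ^ DIM('a)) * \<psi> \<eta>"
    by (simp only: integral_mult_right_zero integral_complex_of_real gauss_hat_integral mult.commute)
  ultimately show ?thesis by (simp only:)
qed

section \<open>Positivity of stable densities\<close>

text \<open>A convenient substitute for positive definiteness. Quantifying over all \<open>\<delta>\<close> makes closure under
  multiplication by Gaussians trivial, and the factor \<^term>\<open>gauss \<delta>\<close> makes bounded pointwise limits
  accessible to dominated convergence.\<close>

definition pos_type :: "('a::euclidean_space \<Rightarrow> real) set" where
  "pos_type = {h \<in> borel_measurable borel. (\<exists>B. \<forall>\<xi>. \<bar>h \<xi>\<bar> \<le> B) \<and>
     (\<forall>\<delta>>0. \<forall>x. fourier_plus (\<lambda>\<xi>. of_real (h \<xi> * gauss \<delta> \<xi>)) x \<in> \<real>\<^sub>\<ge>\<^sub>0)}"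

lemma pos_type_measurable: "h \<in> pos_type \<Longrightarrow> h \<in> borel_measurable borel"
  by (simp add: pos_type_def)

lemma pos_type_bounded: "h \<in> pos_type \<Longrightarrow> \<exists>B. \<forall>\<xi>. \<bar>h \<xi>\<bar> \<le> B"
  by (simp add: pos_type_def)

lemma pos_typeD: "h \<in> pos_type \<Longrightarrow> \<delta> > 0 \<Longrightarrow> fourier_plus (\<lambda>\<xi>. of_real (h \<xi> * gauss \<delta> \<xi>)) x \<in> \<real>\<^sub>\<ge>\<^sub>0"
  by (simp add: pos_type_def)

lemma integrable_bounded_mult_gauss:
  fixes h :: "'a::euclidean_space \<Rightarrow> real"
  assumes [measurable]: "h \<in> borel_measurable borel" and B: "\<And>\<xi>. \<bar>h \<xi>\<bar> \<le> B" and \<delta>: "\<delta> > 0"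
  shows "integrable lborel (\<lambda>\<xi>. h \<xi> * gauss \<delta> \<xi>)"
proof (rule Bochner_Integration.integrable_bound)
  show "integrable lborel (\<lambda>\<xi>::'a. B * gauss \<delta> \<xi>)" by (intro integrable_mult_right gauss_integrable \<delta>)
  show "AE \<xi> in lborel. norm (h \<xi> * gauss \<delta> \<xi>) \<le> norm (B * gauss \<delta> \<xi>)"
    using B by (auto simp: abs_mult intro!: mult_right_mono order_trans[OF B abs_ge_self])
qed measurable

lemma fourier_plus_add:
  assumes "integrable lborel f" "integrable lborel g"
  shows "fourier_plus (\<lambda>\<xi>. f \<xi> + g \<xi>) x = fourier_plus f x + fourier_plus g x"
  unfolding fourier_plus_def distrib_left
  by (intro Bochner_Integration.integral_add integrable_cis_mult assms) auto

lemma fourier_plus_cmult: "fourier_plus (\<lambda>\<xi>. c * f \<xi>) x = c * fourier_plus f x"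
  unfolding fourier_plus_def mult.left_commute[of _ c] by (rule integral_mult_right_zero)

lemma pos_type_add:
  assumes f: "f \<in> pos_type" and g: "g \<in> pos_type"
  shows "(\<lambda>\<xi>. f \<xi> + g \<xi>) \<in> pos_type"
proof -
  note [measurable] = pos_type_measurable[OF f] pos_type_measurable[OF g]
  obtain A B where A: "\<And>\<xi>. \<bar>f \<xi>\<bar> \<le> A" and B: "\<And>\<xi>. \<bar>g \<xi>\<bar> \<le> B"
    using f g pos_type_bounded by metis
  have "fourier_plus (\<lambda>\<xi>. of_real ((f \<xi> + g \<xi>) * gauss \<delta> \<xi>)) x \<in> \<real>\<^sub>\<ge>\<^sub>0" if "\<delta> > 0" for \<delta> x
  proof -
    have "fourier_plus (\<lambda>\<xi>. of_real (f \<xi> * gauss \<delta> \<xi>) + of_real (g \<xi> * gauss \<delta> \<xi>)) x \<in> \<real>\<^sub>\<ge>\<^sub>0"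
      using that f g A B
      by (subst fourier_plus_add)
         (auto intro!: nonneg_Reals_add_I pos_typeD integrable_of_real integrable_bounded_mult_gauss simp del: of_real_mult)
    then show ?thesis by (simp add: distrib_right)
  qed
  moreover have "\<bar>f \<xi> + g \<xi>\<bar> \<le> A + B" for \<xi> using A[of \<xi>] B[of \<xi>] by linarith
  ultimately show ?thesis by (auto simp: pos_type_def simp del: of_real_mult)
qed

lemma pos_type_cmult:
  assumes f: "f \<in> pos_type" and c: "c \<ge> 0"
  shows "(\<lambda>\<xi>. c * f \<xi>) \<in> pos_type"
proof -
  note [measurable] = pos_type_measurable[OF f]
  obtain A where A: "\<And>\<xi>. \<bar>f \<xi>\<bar> \<le> A" using f pos_type_bounded by metis
  have "fourier_plus (\<lambda>\<xi>. of_real ((c * f \<xi>) * gauss \<delta> \<xi>)) x \<in> \<real>\<^sub>\<ge>\<^sub>0" if "\<delta> > 0" for \<delta> x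
  proof -
    have "of_real c * fourier_plus (\<lambda>\<xi>. of_real (f \<xi> * gauss \<delta> \<xi>)) x \<in> \<real>\<^sub>\<ge>\<^sub>0"
      using that f c by (intro nonneg_Reals_mult_I pos_typeD) auto
    then show ?thesis unfolding fourier_plus_cmult[symmetric] by (simp add: mult_ac)
  qed
  moreover have "\<bar>c * f \<xi>\<bar> \<le> c * A" for \<xi> using A[of \<xi>] c by (simp add: abs_mult mult_left_mono)
  ultimately show ?thesis by (auto simp: pos_type_def simp del: of_real_mult)
qed

lemma fourier_plus_dominated:
  fixes f :: "nat \<Rightarrow> 'a::euclidean_space \<Rightarrow> complex"
  assumes "\<And>k. f k \<in> borel_measurable borel" "g \<in> borel_measurable borel" "integrable lborel w"
    and "\<And>k \<xi>. norm (f k \<xi>) \<le> w \<xi>" "\<And>\<xi>. (\<lambda>k. f k \<xi>) \<longlonglongrightarrow> g \<xi>"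
  shows "(\<lambda>k. fourier_plus (f k) x) \<longlonglongrightarrow> fourier_plus g x"
  unfolding fourier_plus_def
  by (rule integral_dominated_convergence[where w = w])
     (use assms in \<open>auto simp: norm_mult intro!: tendsto_intros\<close>)

lemma pos_type_limit:
  assumes h: "\<And>k. h k \<in> pos_type" and B: "\<And>k \<xi>. \<bar>h k \<xi>\<bar> \<le> B" and lim: "\<And>\<xi>. (\<lambda>k. h k \<xi>) \<longlonglongrightarrow> g \<xi>"
  shows "g \<in> pos_type"
proof -
  note [measurable] = pos_type_measurable[OF h]
  have g [measurable]: "g \<in> borel_measurable borel" by (rule borel_measurable_LIMSEQ_real[OF lim]) measurable
  have "fourier_plus (\<lambda>\<xi>. of_real (g \<xi> * gauss \<delta> \<xi>)) x \<in> \<real>\<^sub>\<ge>\<^sub>0" if "\<delta> > 0" for \<delta> x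
  proof (rule closed_sequentially)
    show "(\<lambda>k. fourier_plus (\<lambda>\<xi>. of_real (h k \<xi> * gauss \<delta> \<xi>)) x) \<longlonglongrightarrow>
        fourier_plus (\<lambda>\<xi>. of_real (g \<xi> * gauss \<delta> \<xi>)) x"
    proof (rule fourier_plus_dominated)
      show "integrable lborel (\<lambda>\<xi>. B * gauss \<delta> \<xi>)" by (intro integrable_mult_right gauss_integrable that)
      show "norm (complex_of_real (h k \<xi> * gauss \<delta> \<xi>)) \<le> B * gauss \<delta> \<xi>" for k \<xi>
        using B by (auto simp: norm_mult intro!: mult_right_mono)
      show "(\<lambda>k. complex_of_real (h k \<xi> * gauss \<delta> \<xi>)) \<longlonglongrightarrow> of_real (g \<xi> * gauss \<delta> \<xi>)" for \<xi>
        by (intro tendsto_intros lim)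
    qed measurable
  qed (use h that in \<open>auto intro!: pos_typeD simp del: of_real_mult\<close>)
  moreover have "\<bar>g \<xi>\<bar> \<le> B" for \<xi>
    by (rule tendsto_upperbound[OF tendsto_rabs[OF lim]]) (use B in auto)
  ultimately show ?thesis using g by (auto simp: pos_type_def simp del: of_real_mult)
qed

lemma pos_type_1: "(\<lambda>_. 1) \<in> pos_type"
  by (auto simp: pos_type_def fourier_gauss)

lemma pos_type_0: "(\<lambda>_. 0) \<in> pos_type"
  using pos_type_cmult[OF pos_type_1, of 0] by simp

lemma pos_type_mult_gauss:
  assumes h: "h \<in> pos_type" and "\<tau> \<ge> 0"
  shows "(\<lambda>\<xi>. h \<xi> * gauss \<tau> \<xi>) \<in> pos_type"
proof -
  note [measurable] = pos_type_measurable[OF h]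
  obtain A where A: "\<And>\<xi>. \<bar>h \<xi>\<bar> \<le> A" using h pos_type_bounded by metis
  have "\<bar>h \<xi> * gauss \<tau> \<xi>\<bar> \<le> A * 1" for \<xi>
    unfolding abs_mult using gauss_le_1[OF assms(2), of \<xi>] order_trans[OF abs_ge_zero A]
    by (intro mult_mono A) auto
  moreover have "fourier_plus (\<lambda>\<xi>. of_real (h \<xi> * gauss \<tau> \<xi> * gauss \<delta> \<xi>)) x \<in> \<real>\<^sub>\<ge>\<^sub>0" if "\<delta> > 0" for \<delta> x
  proof -
    have eq: "h \<xi> * gauss \<tau> \<xi> * gauss \<delta> \<xi> = h \<xi> * gauss (\<tau> + \<delta>) \<xi>" for \<xi>
      by (simp add: gauss_def mult.assoc add_divide_distrib left_diff_distrib flip: exp_add)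
    show ?thesis unfolding eq using assms(2) that by (intro pos_typeD[OF h]) simp
  qed
  ultimately show ?thesis by (auto simp: pos_type_def simp del: of_real_mult)
qed

text \<open>Multipliers of \<open>pos_type\<close> are easier to handle than products within
  \<open>pos_type\<close>: they compose by definition, whereas a product of two members would call
  for a convolution argument.\<close>

definition pos_mult :: "('a::euclidean_space \<Rightarrow> real) set" where
  "pos_mult = {Y. \<forall>h\<in>pos_type. (\<lambda>\<xi>. h \<xi> * Y \<xi>) \<in> pos_type}"

lemma pos_mult_pos_type: "Y \<in> pos_mult \<Longrightarrow> Y \<in> pos_type"
  using pos_type_1 by (force simp: pos_mult_def)

lemma pos_mult_cmult_gauss: "c \<ge> 0 \<Longrightarrow> \<tau> \<ge> 0 \<Longrightarrow> (\<lambda>\<xi>. c * gauss \<tau> \<xi>) \<in> pos_mult"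
  using pos_type_cmult[OF pos_type_mult_gauss] by (auto simp: pos_mult_def mult.left_commute)

text \<open>Partial sums applied to h are non-negative combinations of elements of
  \<open>pos_type\<close>. As all terms are non-negative, these sums stay below Z and hence below L,
  which is the uniform bound required for the limit.\<close>

lemma pos_mult_series:
  fixes Y Z :: "'a::euclidean_space \<Rightarrow> real" and a :: "nat \<Rightarrow> real"
  assumes Y: "Y \<in> pos_mult" "\<And>\<xi>. 0 \<le> Y \<xi>" and a: "\<And>k. a k \<ge> 0"
    and Z: "\<And>\<xi>. (\<lambda>k. a k * Y \<xi> ^ k) sums Z \<xi>" "\<And>\<xi>. Z \<xi> \<le> L"
  shows "Z \<in> pos_mult"
  unfolding pos_mult_def mem_Collect_eq
proof
  fix h :: "'a \<Rightarrow> real" assume h: "h \<in> pos_type"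
  obtain A where A: "\<And>\<xi>. \<bar>h \<xi>\<bar> \<le> A" using h pos_type_bounded by metis
  have pow: "(\<lambda>\<xi>. h \<xi> * Y \<xi> ^ k) \<in> pos_type" for k
  proof (induction k)
    case (Suc k)
    then have "(\<lambda>\<xi>. h \<xi> * Y \<xi> ^ k * Y \<xi>) \<in> pos_type" using Y(1) by (simp add: pos_mult_def)
    then show ?case by (simp add: mult_ac)
  qed (use h in simp)
  have sum: "(\<lambda>\<xi>. h \<xi> * (\<Sum>k<m. a k * Y \<xi> ^ k)) \<in> pos_type" for m
  proof (induction m)
    case (Suc m)
    have "(\<lambda>\<xi>. h \<xi> * (\<Sum>k<m. a k * Y \<xi> ^ k) + a m * (h \<xi> * Y \<xi> ^ m)) \<in> pos_type"
      by (intro pos_type_add Suc pos_type_cmult pow a)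
    then show ?case by (simp add: distrib_left mult_ac)
  qed (simp add: pos_type_0)
  show "(\<lambda>\<xi>. h \<xi> * Z \<xi>) \<in> pos_type"
  proof (rule pos_type_limit[OF sum])
    show "(\<lambda>m. h \<xi> * (\<Sum>k<m. a k * Y \<xi> ^ k)) \<longlonglongrightarrow> h \<xi> * Z \<xi>" for \<xi>
      using Z(1)[of \<xi>] unfolding sums_def by (intro tendsto_intros)
    fix m \<xi>
    have "0 \<le> (\<Sum>k<m. a k * Y \<xi> ^ k)" using a Y(2) by (intro sum_nonneg mult_nonneg_nonneg) auto
    moreover have "(\<Sum>k<m. a k * Y \<xi> ^ k) \<le> Z \<xi>"
      unfolding sums_unique[OF Z(1)] using a Y(2)
      by (intro sum_le_suminf sums_summable[OF Z(1)]) auto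
    ultimately have "\<bar>\<Sum>k<m. a k * Y \<xi> ^ k\<bar> \<le> L" using Z(2)[of \<xi>] by linarith
    then show "\<bar>h \<xi> * (\<Sum>k<m. a k * Y \<xi> ^ k)\<bar> \<le> A * L"
      unfolding abs_mult using order_trans[OF abs_ge_zero A] by (intro mult_mono A) auto
  qed
qed

text \<open>The value at k = 0 is - \<beta>, and each further step multiplies by (k + 1 - \<beta>) /
  (k + 2) \<ge> 0. Hence all coefficients of 1 - (1 - y)^\<beta> are non-negative.\<close>

lemma gbinomial_alternating_nonpos:
  fixes \<beta> :: real
  assumes "0 \<le> \<beta>" "\<beta> \<le> 1"
  shows "(\<beta> gchoose Suc k) * (- 1) ^ Suc k \<le> 0"
proof (induction k)
  case (Suc k)
  have "real (Suc (Suc k)) * (\<beta> gchoose Suc (Suc k)) = (\<beta> gchoose Suc k) * (\<beta> - real (Suc k))"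
    using gbinomial_mult_1'[of \<beta> "Suc k"] by (simp add: algebra_simps)
  then have "(\<beta> gchoose Suc (Suc k)) = (\<beta> gchoose Suc k) * (\<beta> - real (Suc k)) / real (Suc (Suc k))"
    by (simp add: field_simps del: of_nat_Suc)
  then have "(\<beta> gchoose Suc (Suc k)) * (- 1) ^ Suc (Suc k) =
      (\<beta> gchoose Suc k) * (- 1) ^ Suc k * ((real (Suc k) - \<beta>) / real (Suc (Suc k)))"
  proof -
    have "G * (\<beta> - K) / M * (- 1 * s) = G * s * ((K - \<beta>) / M)" for G K M s
      by (cases "M = 0") (simp_all add: field_simps)
    then show ?thesis unfolding \<open>(\<beta> gchoose Suc (Suc k)) = _\<close> power_Suc[of _ "Suc k"] .
  qed
  moreover have "0 \<le> (real (Suc k) - \<beta>) / real (Suc (Suc k))" using assms by simp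
  ultimately show ?case using Suc by (simp only: mult_nonpos_nonneg)
qed (use assms in simp)

text \<open>Two series with non-negative coefficients are composed: the binomial series for B = 1 -
  (1 - Y)^\<beta> and the exponential series in c * B. The remaining factor exp(- c) is a positive
  constant.\<close>

lemma pos_mult_exp_one_minus_powr:
  fixes Y :: "'a::euclidean_space \<Rightarrow> real"
  assumes Y: "Y \<in> pos_mult" "\<And>\<xi>. 0 \<le> Y \<xi>" "\<And>\<xi>. Y \<xi> < 1" and \<beta>: "0 < \<beta>" "\<beta> \<le> 1" and c: "c \<ge> 0"
  shows "(\<lambda>\<xi>. exp (- c * (1 - Y \<xi>) powr \<beta>)) \<in> pos_type"
proof -
  let ?a = "\<lambda>k. if k = 0 then 0 else - ((\<beta> gchoose k) * (- 1) ^ k)"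
  let ?B = "\<lambda>\<xi>. 1 - (1 - Y \<xi>) powr \<beta>"
  have B: "?B \<in> pos_mult"
  proof (rule pos_mult_series[OF Y(1,2)])
    show "0 \<le> ?a k" for k using gbinomial_alternating_nonpos[of \<beta> "k - 1"] \<beta> by (cases k) auto
    show "(\<lambda>k. ?a k * Y \<xi> ^ k) sums ?B \<xi>" for \<xi>
    proof -
      have "(\<lambda>k. (\<beta> gchoose k) * (- Y \<xi>) ^ k) sums (1 + - Y \<xi>) powr \<beta>"
        using Y(2,3)[of \<xi>] by (intro gen_binomial_real) auto
      moreover have "(\<lambda>k. if k = 0 then 1 else 0 :: real) sums 1"
        using sums_single[of 0 "\<lambda>_. 1 :: real"] by simp
      ultimately have "(\<lambda>k. (if k = 0 then 1 else 0) - (\<beta> gchoose k) * (- Y \<xi>) ^ k) sums ?B \<xi>"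
        using sums_diff by fastforce
      moreover have "(if k = 0 then 1 else 0) - (\<beta> gchoose k) * (- Y \<xi>) ^ k = ?a k * Y \<xi> ^ k" for k
        by (auto simp: power_minus[of "Y \<xi>"])
      ultimately show ?thesis by simp
    qed
    show "?B \<xi> \<le> 1" for \<xi> by simp
  qed
  have B0: "0 \<le> ?B \<xi>" for \<xi>
    using Y(2,3)[of \<xi>] powr_mono2[of \<beta> "1 - Y \<xi>" 1] \<beta> by simp
  have "(\<lambda>\<xi>. exp (c * ?B \<xi>)) \<in> pos_mult"
  proof (rule pos_mult_series[OF B B0])
    show "0 \<le> c ^ k / fact k" for k using c by simp
    show "(\<lambda>k. c ^ k / fact k * ?B \<xi> ^ k) sums exp (c * ?B \<xi>)" for \<xi>
      using exp_converges[of "c * ?B \<xi>"] unfolding power_mult_distrib by (simp add: divide_inverse mult_ac)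
    show "exp (c * ?B \<xi>) \<le> exp (c * 1)" for \<xi> using c by (subst exp_le_cancel_iff, intro mult_left_mono) auto
  qed
  then have "(\<lambda>\<xi>. exp (- c) * exp (c * ?B \<xi>)) \<in> pos_type"
    by (intro pos_type_cmult pos_mult_pos_type) auto
  then show ?thesis by (simp add: algebra_simps flip: exp_add)
qed

text \<open>Subordination in discrete form: \<open>1 - (1 - y) powr \<beta>\<close> is a power series in \<open>y\<close> with non-negative
  coefficients, and \<open>(1 - exp (- \<tau> * s)) / \<tau>\<close> tends to \<open>s\<close> as \<open>\<tau>\<close> tends to \<open>0\<close>. The additional \<open>\<tau>\<^sup>2\<close> in the
  exponent keeps \<open>y\<close> inside the disc of convergence at \<open>s = 0\<close>.\<close>

lemma pos_type_exp_powr: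
  assumes \<alpha>: "0 < \<alpha>" "\<alpha> \<le> 2" and t: "t \<ge> 0"
  shows "(\<lambda>\<xi>. exp (- t * norm (\<xi>::'a::euclidean_space) powr \<alpha>)) \<in> pos_type"
proof -
  define \<beta> where "\<beta> = \<alpha> / 2"
  have \<beta>: "0 < \<beta>" "\<beta> \<le> 1" using \<alpha> by (auto simp: \<beta>_def)
  define \<tau> where "\<tau> = (\<lambda>j. 1 / (real j + 1))"
  have \<tau>: "\<tau> j > 0" for j by (simp add: \<tau>_def)
  \<comment> \<open>The 2 cancels the 1/2 in \<open>gauss\<close>, so the exponent is - \<tau>_j
    (|\<xi>|^2 + \<tau>_j).\<close>
  let ?Y = "\<lambda>j \<xi>. exp (- (\<tau> j)\<^sup>2) * gauss (2 * \<tau> j) (\<xi> :: 'a)"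
  have Y1: "?Y j \<xi> < 1" for j \<xi>
  proof -
    have "?Y j \<xi> \<le> exp (- (\<tau> j)\<^sup>2) * 1" using \<tau>[of j] by (intro mult_left_mono gauss_le_1) auto
    also have "\<dots> < 1" using \<tau>[of j] by simp
    finally show ?thesis .
  qed
  show ?thesis
  proof (rule pos_type_limit)
    show "(\<lambda>\<xi>. exp (- (t / \<tau> j powr \<beta>) * (1 - ?Y j \<xi>) powr \<beta>)) \<in> pos_type" for j
      using \<tau>[of j] t \<beta> Y1 by (intro pos_mult_exp_one_minus_powr pos_mult_cmult_gauss) auto
    show "\<bar>exp (- (t / \<tau> j powr \<beta>) * (1 - ?Y j \<xi>) powr \<beta>)\<bar> \<le> 1" for j \<xi>
      using t by simp
    fix \<xi> :: 'a
    define s where "s = (norm \<xi>)\<^sup>2"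
    have s: "s \<ge> 0" by (simp add: s_def)
    have Y: "?Y j \<xi> = exp (- \<tau> j * (s + \<tau> j))" for j
      by (simp add: gauss_def s_def power2_eq_square algebra_simps flip: exp_add)
    have "(\<lambda>j. (1 - exp (- \<tau> j * (s + \<tau> j))) / \<tau> j) \<longlonglongrightarrow> s"
    proof (cases "s = 0")
      case True then show ?thesis unfolding \<tau>_def by simp real_asymp
    next
      case False
      then have "s > 0" using s by simp
      then show ?thesis unfolding \<tau>_def by real_asymp
    qed
    then have "(\<lambda>j. ((1 - exp (- \<tau> j * (s + \<tau> j))) / \<tau> j) powr \<beta>) \<longlonglongrightarrow> s powr \<beta>"
    proof (rule tendsto_powr'[OF _ tendsto_const])
      \<comment> \<open>At s = 0 the base of the power tends to 0, where continuity of
        \<open>powr\<close> needs a positive exponent and an eventually non-negative base.\<close>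
      have "exp (- \<tau> j * (s + \<tau> j)) \<le> 1" for j using Y1[of j \<xi>] Y[of j] by simp
      then have "\<forall>\<^sub>F j in sequentially. 0 \<le> (1 - exp (- \<tau> j * (s + \<tau> j))) / \<tau> j"
        using \<tau> by (intro always_eventually allI divide_nonneg_nonneg) (auto intro: less_imp_le)
      then show "s \<noteq> 0 \<or> (0 < \<beta> \<and> (\<forall>\<^sub>F j in sequentially. 0 \<le> (1 - exp (- \<tau> j * (s + \<tau> j))) / \<tau> j))"
        using \<beta> by simp
    qed
    also have "(\<lambda>j. ((1 - exp (- \<tau> j * (s + \<tau> j))) / \<tau> j) powr \<beta>) = (\<lambda>j. (1 - ?Y j \<xi>) powr \<beta> / \<tau> j powr \<beta>)"
      using \<tau> Y1[of _ \<xi>] by (auto simp: Y powr_divide less_imp_le)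
    also have "s powr \<beta> = norm \<xi> powr \<alpha>"
      by (cases "\<xi> = 0") (auto simp: s_def \<beta>_def powr_powr simp flip: powr_numeral)
    finally have "(\<lambda>j. exp (- t * ((1 - ?Y j \<xi>) powr \<beta> / \<tau> j powr \<beta>))) \<longlonglongrightarrow> exp (- t * norm \<xi> powr \<alpha>)"
      by (intro tendsto_intros)
    then show "(\<lambda>j. exp (- (t / \<tau> j powr \<beta>) * (1 - ?Y j \<xi>) powr \<beta>)) \<longlonglongrightarrow> exp (- t * norm \<xi> powr \<alpha>)"
      by simp
  qed
qed

text \<open>The Gaussian factor is removed by letting its parameter tend to 0; integrability of h
  supplies the dominating function.\<close>

lemma pos_type_fourier_plus:
  assumes h: "h \<in> pos_type" and int: "integrable lborel h"
  shows "fourier_plus (\<lambda>\<xi>. of_real (h \<xi>)) x \<in> \<real>\<^sub>\<ge>\<^sub>0"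
proof (rule closed_sequentially)
  note [measurable] = pos_type_measurable[OF h]
  show "(\<lambda>k. fourier_plus (\<lambda>\<xi>. of_real (h \<xi> * gauss (1 / real (Suc k)) \<xi>)) x) \<longlonglongrightarrow> fourier_plus (\<lambda>\<xi>. of_real (h \<xi>)) x"
  proof (rule fourier_plus_dominated)
    show "integrable lborel (\<lambda>\<xi>. \<bar>h \<xi>\<bar>)" using int by simp
    show "norm (complex_of_real (h \<xi> * gauss (1 / real (Suc k)) \<xi>)) \<le> \<bar>h \<xi>\<bar>" for k \<xi>
      by (simp add: norm_mult mult_left_le gauss_le_1)
    have "(\<lambda>k. gauss (1 / real (Suc k)) \<xi>) \<longlonglongrightarrow> exp (- 0 * (norm \<xi>)\<^sup>2 / 2)" for \<xi> :: 'a
      unfolding gauss_def by (intro tendsto_intros lim_1_over_n[THEN LIMSEQ_Suc]) auto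
    then have "(\<lambda>k. complex_of_real (h \<xi> * gauss (1 / real (Suc k)) \<xi>)) \<longlonglongrightarrow> of_real (h \<xi> * 1)" for \<xi>
      by (intro tendsto_intros) simp
    then show "(\<lambda>k. complex_of_real (h \<xi> * gauss (1 / real (Suc k)) \<xi>)) \<longlonglongrightarrow> of_real (h \<xi>)" for \<xi>
      by simp
  qed measurable
qed (use h in \<open>auto intro!: pos_typeD simp del: of_real_mult\<close>)

section \<open>The fractional heat kernel\<close>

text \<open>For \<open>t \<le> 0\<close> the symbol is not integrable and the kernel is the junk value \<open>0\<close>; in this way it is
  jointly measurable on all of \<open>\<real> \<times> \<real>\<^sup>n\<close>.\<close>

definition frac_kernel :: "real \<Rightarrow> real \<Rightarrow> 'a::euclidean_space \<Rightarrow> real" where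
  "frac_kernel \<alpha> t x =
    Re (fourier_plus (\<lambda>\<xi>. of_real (exp (- t * norm \<xi> powr \<alpha>))) x) / (2 * pi) ^ DIM('a)"

lemma frac_kernel_measurable_pair [measurable]:
  "(\<lambda>(t, x::'a::euclidean_space). frac_kernel \<alpha> t x) \<in> borel_measurable (borel \<Otimes>\<^sub>M borel)"
  unfolding frac_kernel_def fourier_plus_def by measurable

lemma frac_kernel_measurable [measurable (raw)]:
  assumes [measurable]: "f \<in> borel_measurable M" "g \<in> borel_measurable M"
  shows "(\<lambda>w. frac_kernel \<alpha> (f w) (g w :: 'a::euclidean_space)) \<in> borel_measurable M"
  using measurable_compose[OF measurable_Pair[OF assms] frac_kernel_measurable_pair] by simp

lemma fourier_transform_eq: "fourier_transform h \<xi> = fourier_plus (\<lambda>x. of_real (h x)) (- \<xi>)"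
  by (simp add: fourier_transform_def fourier_plus_def inner_commute)

section \<open>Gaussian averages of integrable functions and injectivity of the Fourier
  transform\<close>

lemma gauss_hat_away_tendsto_0:
  fixes \<eta> :: "'a::euclidean_space"
  assumes h: "integrable lborel (h :: 'a \<Rightarrow> real)" and r: "r > 0" "\<And>\<xi>. dist \<eta> \<xi> < r \<Longrightarrow> h \<xi> = 0"
  shows "(\<lambda>k. LINT \<xi>|lborel. h \<xi> * gauss_hat (1 / real (Suc k)) (\<xi> - \<eta>)) \<longlonglongrightarrow> 0"
proof (rule Lim_null_comparison)
  \<comment> \<open>The bound for the Gaussian outside the ball of radius r about \<eta>:
    exponential decay in k against a polynomial prefactor.\<close>
  let ?u = "\<lambda>k. sqrt (2 * pi * real (Suc k)) ^ DIM('a) * exp (- r\<^sup>2 * real (Suc k) / 2)"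
  let ?I = "LINT \<xi>|lborel. \<bar>h \<xi>\<bar>"
  have [measurable]: "h \<in> borel_measurable borel" using h by auto
  have "?u \<longlonglongrightarrow> 0" using r(1) by real_asymp
  from tendsto_mult_right[OF this, of ?I] show "(\<lambda>k. ?u k * ?I) \<longlonglongrightarrow> 0" by simp
  have "norm (LINT \<xi>|lborel. h \<xi> * gauss_hat (1 / real (Suc k)) (\<xi> - \<eta>)) \<le> ?u k * ?I" for k
  proof -
    have *: "norm (h \<xi> * gauss_hat (1 / real (Suc k)) (\<xi> - \<eta>)) \<le> ?u k * \<bar>h \<xi>\<bar>" for \<xi>
    proof (cases "dist \<eta> \<xi> < r")
      case False
      then have "r\<^sup>2 \<le> (norm (\<xi> - \<eta>))\<^sup>2"
        using r(1) by (intro power_mono) (auto simp: dist_norm norm_minus_commute)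
      then have "r\<^sup>2 * real (Suc k) / 2 \<le> (norm (\<xi> - \<eta>))\<^sup>2 * real (Suc k) / 2"
        by (intro divide_right_mono mult_right_mono) auto
      then have "gauss_hat (1 / real (Suc k)) (\<xi> - \<eta>) \<le> ?u k"
        unfolding gauss_hat_def by (intro mult_mono) (auto simp: field_simps)
      then show ?thesis by (simp add: abs_mult mult.commute mult_left_mono)
    qed (simp add: r(2))
    have int: "integrable lborel (\<lambda>\<xi>. ?u k * \<bar>h \<xi>\<bar>)" using h by (intro integrable_mult_right) simp
    have "norm (LINT \<xi>|lborel. h \<xi> * gauss_hat (1 / real (Suc k)) (\<xi> - \<eta>)) \<le> (LINT \<xi>|lborel. ?u k * \<bar>h \<xi>\<bar>)"
      by (rule order_trans[OF integral_norm_bound integral_mono'[OF int *]]) simp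
    then show ?thesis by simp
  qed
  then show "\<forall>\<^sub>F k in sequentially. norm (LINT \<xi>|lborel. h \<xi> * gauss_hat (1 / real (Suc k)) (\<xi> - \<eta>)) \<le> ?u k * ?I"
    by simp
qed

text \<open>As h may be unbounded, it is cut at a ball on which it differs from h \<eta> by less
  than 1. The inner part is bounded and falls under \<open>gauss_hat_approx\<close>; the outer part
  is integrable and contributes nothing in the limit.\<close>

lemma gauss_hat_approx_integrable:
  fixes \<eta> :: "'a::euclidean_space"
  assumes h: "integrable lborel (h :: 'a \<Rightarrow> real)" and c: "isCont h \<eta>"
  shows "(\<lambda>k. LINT \<xi>|lborel. h \<xi> * gauss_hat (1 / real (Suc k)) (\<xi> - \<eta>)) \<longlonglongrightarrow> (2 * pi) ^ DIM('a) * h \<eta>"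
proof -
  have [measurable]: "h \<in> borel_measurable borel" using h by auto
  obtain r where r: "r > 0" "\<And>\<xi>. dist \<xi> \<eta> < r \<Longrightarrow> dist (h \<xi>) (h \<eta>) < 1"
    using c unfolding continuous_at_eps_delta by (meson zero_less_one)
  define h1 where "h1 = (\<lambda>\<xi>. h \<xi> * indicator (ball \<eta> r) \<xi>)"
  define h2 where "h2 = (\<lambda>\<xi>. h \<xi> * indicator (- ball \<eta> r) \<xi>)"
  have [measurable]: "ball \<eta> r \<in> sets borel" by simp
  have [measurable]: "h1 \<in> borel_measurable borel" unfolding h1_def by measurable
  let ?g = "\<lambda>k \<xi>. gauss_hat (1 / real (Suc k)) (\<xi> - \<eta>)"
  have h1_bdd: "norm (complex_of_real (h1 \<xi>)) \<le> \<bar>h \<eta>\<bar> + 1" for \<xi>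
    using r(2)[of \<xi>] by (auto simp: h1_def dist_real_def dist_commute split: split_indicator)
  have "\<forall>\<^sub>F \<xi> in nhds \<eta>. h1 \<xi> = h \<xi>"
    using r(1) unfolding eventually_nhds_metric h1_def by (auto simp: dist_commute intro!: exI[of _ r])
  then have "isCont h1 \<eta>" using c isCont_cong by blast
  then have "isCont (\<lambda>\<xi>. complex_of_real (h1 \<xi>)) \<eta>" by (intro continuous_intros)
  from gauss_hat_approx[OF _ h1_bdd this, of "\<lambda>k. 1 / real (Suc k)"]
  have "(\<lambda>k. complex_of_real (LINT \<xi>|lborel. h1 \<xi> * ?g k \<xi>)) \<longlonglongrightarrow> of_real ((2 * pi) ^ DIM('a) * h1 \<eta>)"
    using LIMSEQ_Suc[OF lim_1_over_n] by (simp flip: integral_complex_of_real)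
  then have 1: "(\<lambda>k. LINT \<xi>|lborel. h1 \<xi> * ?g k \<xi>) \<longlonglongrightarrow> (2 * pi) ^ DIM('a) * h \<eta>"
    using r(1) by (simp only: tendsto_of_real_iff) (simp add: h1_def)
  have int2: "integrable lborel h2" unfolding h2_def by (intro integrable_real_mult_indicator h) auto
  have 2: "(\<lambda>k. LINT \<xi>|lborel. h2 \<xi> * ?g k \<xi>) \<longlonglongrightarrow> 0"
    by (rule gauss_hat_away_tendsto_0[OF int2 r(1)]) (simp add: h2_def)
  have gint: "integrable lborel (?g k)" for k
    using integrable_lborel_affine[OF gauss_hat_integrable[of "1 / real (Suc k)", where 'a = 'a], of 1 "- \<eta>"] by simp
  have gle: "?g k \<xi> \<le> sqrt (2 * pi * real (Suc k)) ^ DIM('a)" for k \<xi>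
    unfolding gauss_hat_def by (simp add: mult_left_le)
  have i1: "integrable lborel (\<lambda>\<xi>. h1 \<xi> * ?g k \<xi>)" for k
  proof (rule Bochner_Integration.integrable_bound)
    show "integrable lborel (\<lambda>\<xi>. (\<bar>h \<eta>\<bar> + 1) * ?g k \<xi>)" by (intro integrable_mult_right gint)
    show "AE \<xi> in lborel. norm (h1 \<xi> * ?g k \<xi>) \<le> norm ((\<bar>h \<eta>\<bar> + 1) * ?g k \<xi>)"
      using h1_bdd by (auto simp: abs_mult intro!: mult_right_mono)
  qed measurable
  have i2: "integrable lborel (\<lambda>\<xi>. h2 \<xi> * ?g k \<xi>)" for k
  proof (rule Bochner_Integration.integrable_bound)
    show "integrable lborel (\<lambda>\<xi>. sqrt (2 * pi * real (Suc k)) ^ DIM('a) * h2 \<xi>)" by (intro integrable_mult_right int2)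
    show "AE \<xi> in lborel. norm (h2 \<xi> * ?g k \<xi>) \<le> norm (sqrt (2 * pi * real (Suc k)) ^ DIM('a) * h2 \<xi>)"
      using mult_right_mono[OF gle, of "\<bar>h2 _\<bar>"] by (auto simp: abs_mult mult.commute)
  qed (use int2 in measurable)
  have "(LINT \<xi>|lborel. h \<xi> * ?g k \<xi>) = (LINT \<xi>|lborel. h1 \<xi> * ?g k \<xi>) + (LINT \<xi>|lborel. h2 \<xi> * ?g k \<xi>)" for k
    unfolding Bochner_Integration.integral_add[OF i1 i2, symmetric]
    by (intro Bochner_Integration.integral_cong) (auto simp: h1_def h2_def split: split_indicator)
  then show ?thesis using tendsto_add[OF 1 2] by simp
qed

text \<open>By the multiplication formula with modulated Gaussians, a vanishing transform makes
  every Gaussian average of h about \<eta> vanish; by continuity these averages recover h \<eta>.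
  The purpose is uniqueness of the kernel.\<close>

lemma fourier_transform_injective:
  fixes h :: "'a::euclidean_space \<Rightarrow> real"
  assumes "continuous_on UNIV h" and h: "integrable lborel h" and 0: "\<And>\<xi>. fourier_transform h \<xi> = 0"
  shows "h \<eta> = 0"
proof -
  let ?d = "\<lambda>k. 1 / real (Suc k)"
  have 1: "(LINT \<xi>|lborel. h \<xi> * gauss_hat (?d k) (\<xi> - \<eta>)) = 0" for k
  proof -
    let ?g = "\<lambda>x. cis (- (x \<bullet> \<eta>)) * complex_of_real (gauss (?d k) x)"
    have "fourier_plus (\<lambda>x. of_real (h x)) x = 0" for x
      using 0[of "- x"] by (simp add: fourier_transform_eq)
    then have "0 = (LINT x|lborel. fourier_plus (\<lambda>x. of_real (h x)) x * ?g x)" by simp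
    also have "\<dots> = (LINT \<xi>|lborel. of_real (h \<xi>) * fourier_plus ?g \<xi>)"
      by (intro fourier_plus_swap integrable_of_real h integrable_cis_mult gauss_integrable) auto
    also have "\<dots> = complex_of_real (LINT \<xi>|lborel. h \<xi> * gauss_hat (?d k) (\<xi> - \<eta>))"
      by (subst fourier_gauss_shift) (simp_all flip: of_real_mult)
    finally show ?thesis by simp
  qed
  have "isCont h \<eta>" using assms(1) by (simp add: continuous_on_eq_continuous_at)
  from gauss_hat_approx_integrable[OF h this] have "(\<lambda>k. 0) \<longlonglongrightarrow> (2 * pi) ^ DIM('a) * h \<eta>"
    unfolding 1 .
  then show ?thesis by (simp add: LIMSEQ_const_iff)
qed

section \<open>The kernel: sign, mass, identification, semigroup law and scaling\<close>

context
  fixes \<alpha> :: real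
  assumes \<alpha>: "0 < \<alpha>" "\<alpha> \<le> 2"
begin

lemma isCont_exp_powr: "isCont (\<lambda>\<xi>::'a::euclidean_space. exp (- t * norm \<xi> powr \<alpha>)) \<eta>"
proof -
  have "((\<lambda>\<xi>. norm \<xi> powr \<alpha>) \<longlongrightarrow> norm \<eta> powr \<alpha>) (at \<eta>)"
  proof (rule tendsto_powr')
    show "norm \<eta> \<noteq> 0 \<or> 0 < \<alpha> \<and> (\<forall>\<^sub>F \<xi> in at \<eta>. 0 \<le> norm \<xi>)" using \<alpha> by simp
  qed (intro tendsto_intros)+
  then show ?thesis unfolding isCont_def by (intro tendsto_exp tendsto_mult[OF tendsto_const])
qed

text \<open>The symbol is integrable and of positive type, so the integral is a non-negative real
  number. This yields the sign and shows that \<open>Re\<close> in the definition discards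
  nothing.\<close>

lemma
  assumes t: "t > 0"
  shows frac_kernel_nonneg: "0 \<le> frac_kernel \<alpha> t (x::'a::euclidean_space)"
    and fourier_plus_exp_powr: "fourier_plus (\<lambda>\<xi>. of_real (exp (- t * norm \<xi> powr \<alpha>))) x =
      of_real ((2 * pi) ^ DIM('a) * frac_kernel \<alpha> t x)"
proof -
  have "fourier_plus (\<lambda>\<xi>. of_real (exp (- t * norm \<xi> powr \<alpha>))) x \<in> \<real>\<^sub>\<ge>\<^sub>0"
    using \<alpha> t by (intro pos_type_fourier_plus pos_type_exp_powr integrable_exp_powr) auto
  then show "0 \<le> frac_kernel \<alpha> t x"
    and "fourier_plus (\<lambda>\<xi>. of_real (exp (- t * norm \<xi> powr \<alpha>))) x = of_real ((2 * pi) ^ DIM('a) * frac_kernel \<alpha> t x)"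
    by (auto simp: frac_kernel_def complex_nonneg_Reals_iff complex_eq_iff)
qed

lemma frac_kernel_continuous:
  assumes t: "t > 0"
  shows "continuous_on UNIV (frac_kernel \<alpha> t :: 'a::euclidean_space \<Rightarrow> real)"
  unfolding frac_kernel_def
  by (intro continuous_on_divide continuous_on_Re continuous_fourier_plus integrable_of_real integrable_exp_powr t \<alpha>)
     auto

lemma frac_kernel_bounded:
  assumes t: "t > 0"
  shows "\<exists>B. \<forall>x::'a::euclidean_space. frac_kernel \<alpha> t x \<le> B"
proof -
  let ?\<psi> = "\<lambda>\<xi>::'a. complex_of_real (exp (- t * norm \<xi> powr \<alpha>))"
  have "frac_kernel \<alpha> t x \<le> (LINT \<xi>|lborel. norm (?\<psi> \<xi>)) / (2 * pi) ^ DIM('a)" for x :: 'a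
    unfolding frac_kernel_def
    by (intro divide_right_mono order_trans[OF complex_Re_le_cmod] norm_fourier_plus_le integrable_of_real integrable_exp_powr t \<alpha>)
       auto
  then show ?thesis by blast
qed

lemma frac_kernel_minus: "frac_kernel \<alpha> t (- x) = frac_kernel \<alpha> t (x::'a::euclidean_space)"
proof -
  have "fourier_plus (\<lambda>\<xi>. of_real (exp (- t * norm \<xi> powr \<alpha>))) x =
    fourier_plus (\<lambda>\<xi>. of_real (exp (- t * norm \<xi> powr \<alpha>))) (- x)"
    unfolding fourier_plus_def by (subst integral_lborel_affine[of _ "- 1" 0]) auto
  then show ?thesis by (simp add: frac_kernel_def)
qed

text \<open>A regularised Fourier inversion, meaningful before the kernel is known to be integrable:
  the multiplication formula moves the transform to the Gaussian, which then acts on the symbol as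
  an approximate identity.\<close>

lemma frac_kernel_gauss_limit:
  fixes \<eta> :: "'a::euclidean_space"
  assumes t: "t > 0"
  shows "(\<lambda>k. LINT x|lborel. cis (- (x \<bullet> \<eta>)) * of_real (frac_kernel \<alpha> t x * gauss (1 / real (Suc k)) x))
    \<longlonglongrightarrow> of_real (exp (- t * norm \<eta> powr \<alpha>))"
proof -
  let ?d = "\<lambda>k. 1 / real (Suc k)"
  let ?\<psi> = "\<lambda>\<xi>::'a. complex_of_real (exp (- t * norm \<xi> powr \<alpha>))"
  let ?C = "complex_of_real ((2 * pi) ^ DIM('a))"
  have "(LINT x|lborel. cis (- (x \<bullet> \<eta>)) * of_real (frac_kernel \<alpha> t x * gauss (?d k) x)) =
      (LINT \<xi>|lborel. ?\<psi> \<xi> * of_real (gauss_hat (?d k) (\<xi> - \<eta>))) / ?C" for k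
  proof -
    let ?g = "\<lambda>x. cis (- (x \<bullet> \<eta>)) * complex_of_real (gauss (?d k) x)"
    have "(LINT \<xi>|lborel. ?\<psi> \<xi> * of_real (gauss_hat (?d k) (\<xi> - \<eta>))) = (LINT \<xi>|lborel. ?\<psi> \<xi> * fourier_plus ?g \<xi>)"
      by (subst fourier_gauss_shift) auto
    also have "\<dots> = (LINT x|lborel. fourier_plus ?\<psi> x * ?g x)"
      by (intro fourier_plus_swap[symmetric] integrable_of_real integrable_exp_powr t \<alpha> integrable_cis_mult gauss_integrable) auto
    also have "\<dots> = (LINT x|lborel. ?C * (cis (- (x \<bullet> \<eta>)) * of_real (frac_kernel \<alpha> t x * gauss (?d k) x)))"
      by (subst fourier_plus_exp_powr[OF t]) (simp add: mult_ac)
    also have "\<dots> = ?C * (LINT x|lborel. cis (- (x \<bullet> \<eta>)) * of_real (frac_kernel \<alpha> t x * gauss (?d k) x))"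
      by (rule integral_mult_right_zero)
    finally show ?thesis by simp
  qed
  moreover have "(\<lambda>k. LINT \<xi>|lborel. ?\<psi> \<xi> * of_real (gauss_hat (?d k) (\<xi> - \<eta>))) \<longlonglongrightarrow> ?C * ?\<psi> \<eta>"
  proof (rule gauss_hat_approx[where B = 1])
    show "isCont ?\<psi> \<eta>" by (intro isCont_of_real isCont_exp_powr)
    show "?d \<longlonglongrightarrow> 0" by (intro LIMSEQ_Suc lim_1_over_n)
  qed (use t in auto)
  ultimately show ?thesis using tendsto_divide[OF _ tendsto_const[of ?C]] by fastforce
qed

text \<open>Since the kernel is non-negative, its Gaussian regularisations increase to it, and
  \<open>frac_kernel_gauss_limit\<close> at frequency 0 gives the limit 1 of their integrals.
  Integrability is thus a conclusion, not an input.\<close>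

lemma frac_kernel_integral:
  assumes t: "t > 0"
  shows "has_bochner_integral lborel (frac_kernel \<alpha> t :: 'a::euclidean_space \<Rightarrow> real) 1"
proof (rule has_bochner_integral_monotone_convergence)
  let ?d = "\<lambda>k. 1 / real (Suc k)"
  obtain B where B: "\<And>x::'a. frac_kernel \<alpha> t x \<le> B" using frac_kernel_bounded[OF t] by blast
  show "integrable lborel (\<lambda>x::'a. frac_kernel \<alpha> t x * gauss (?d k) x)" for k
    using B by (intro integrable_bounded_mult_gauss[where B = B]) (auto simp: frac_kernel_nonneg[OF t])
  have "gauss (?d i) x \<le> gauss (?d j) x" if "i \<le> j" for i j and x :: 'a
    using that unfolding gauss_def by (auto intro!: mult_right_mono simp: frac_le)
  then show "AE x in lborel. mono (\<lambda>k. frac_kernel \<alpha> t (x::'a) * gauss (?d k) x)"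
    by (auto intro!: monoI mult_left_mono simp: frac_kernel_nonneg[OF t])
  have "(\<lambda>k. gauss (1 / real (Suc k)) x) \<longlonglongrightarrow> exp (- 0 * (norm x)\<^sup>2 / 2)" for x :: 'a
    unfolding gauss_def by (intro tendsto_intros lim_1_over_n[THEN LIMSEQ_Suc]) auto
  then show "AE x in lborel. (\<lambda>k. frac_kernel \<alpha> t (x::'a) * gauss (?d k) x) \<longlonglongrightarrow> frac_kernel \<alpha> t x"
    using tendsto_mult[OF tendsto_const, of "\<lambda>k. gauss (?d k) _" 1] by fastforce
  have "(\<lambda>k. complex_of_real (LINT x|lborel. frac_kernel \<alpha> t (x::'a) * gauss (?d k) x)) \<longlonglongrightarrow> of_real 1"
    using frac_kernel_gauss_limit[OF t, of "0::'a"] \<alpha> by (simp flip: integral_complex_of_real)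
  then show "(\<lambda>k. LINT x|lborel. frac_kernel \<alpha> t (x::'a) * gauss (?d k) x) \<longlonglongrightarrow> 1"
    by (simp only: tendsto_of_real_iff)
qed auto

lemma frac_kernel_integrable:
  "t > 0 \<Longrightarrow> integrable lborel (frac_kernel \<alpha> t :: 'a::euclidean_space \<Rightarrow> real)"
  using frac_kernel_integral by (auto simp: has_bochner_integral_iff)

lemma fourier_transform_frac_kernel:
  fixes \<eta> :: "'a::euclidean_space"
  assumes t: "t > 0"
  shows "fourier_transform (frac_kernel \<alpha> t) \<eta> = of_real (exp (- t * norm \<eta> powr \<alpha>))"
proof (rule LIMSEQ_unique[OF _ frac_kernel_gauss_limit[OF t, of \<eta>]])
  let ?d = "\<lambda>k. 1 / real (Suc k)"
  show "(\<lambda>k. LINT x|lborel. cis (- (x \<bullet> \<eta>)) * of_real (frac_kernel \<alpha> t x * gauss (?d k) x))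
    \<longlonglongrightarrow> fourier_transform (frac_kernel \<alpha> t) \<eta>"
    unfolding fourier_transform_def
  proof (rule integral_dominated_convergence[where w = "frac_kernel \<alpha> t"])
    have "(\<lambda>k. gauss (1 / real (Suc k)) x) \<longlonglongrightarrow> exp (- 0 * (norm x)\<^sup>2 / 2)" for x :: 'a
      unfolding gauss_def by (intro tendsto_intros lim_1_over_n[THEN LIMSEQ_Suc]) auto
    then have *: "(\<lambda>k. cis (- (x \<bullet> \<eta>)) * of_real (frac_kernel \<alpha> t x * gauss (?d k) x)) \<longlonglongrightarrow>
        cis (- (x \<bullet> \<eta>)) * of_real (frac_kernel \<alpha> t x * 1)" for x
      by (intro tendsto_intros) simp
    then show "AE x in lborel. (\<lambda>k. cis (- (x \<bullet> \<eta>)) * of_real (frac_kernel \<alpha> t x * gauss (?d k) x)) \<longlonglongrightarrow>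
        cis (- (x \<bullet> \<eta>)) * of_real (frac_kernel \<alpha> t x)" by simp
    show "AE x in lborel. norm (cis (- (x \<bullet> \<eta>)) * of_real (frac_kernel \<alpha> t x * gauss (?d k) x)) \<le> frac_kernel \<alpha> t x" for k
      by (auto simp: norm_mult frac_kernel_nonneg[OF t] intro!: mult_left_le gauss_le_1)
  qed (use frac_kernel_integrable[OF t] in auto)
qed

text \<open>Resolves the definite description: \<open>frac_kernel\<close> meets the three
  requirements, and the difference from any other candidate is continuous and integrable with
  vanishing transform.\<close>

lemma frac_heat_kernel_eq:
  assumes t: "t > 0"
  shows "frac_heat_kernel \<alpha> x t = frac_kernel \<alpha> t (x::'a::euclidean_space)"
proof -
  have "(THE K. continuous_on UNIV K \<and> integrable lborel K \<and>
       (\<forall>\<xi>::'a. fourier_transform K \<xi> = complex_of_real (exp (- t * norm \<xi> powr \<alpha>)))) = frac_kernel \<alpha> t"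
  proof (rule the_equality)
    show "continuous_on UNIV (frac_kernel \<alpha> t) \<and> integrable lborel (frac_kernel \<alpha> t) \<and>
       (\<forall>\<xi>::'a. fourier_transform (frac_kernel \<alpha> t) \<xi> = complex_of_real (exp (- t * norm \<xi> powr \<alpha>)))"
      using frac_kernel_continuous[OF t] frac_kernel_integrable[OF t] fourier_transform_frac_kernel[OF t] by blast
    fix K :: "'a \<Rightarrow> real"
    assume K: "continuous_on UNIV K \<and> integrable lborel K \<and>
       (\<forall>\<xi>. fourier_transform K \<xi> = complex_of_real (exp (- t * norm \<xi> powr \<alpha>)))"
    have "K x - frac_kernel \<alpha> t x = 0" for x
    proof (rule fourier_transform_injective[where h = "\<lambda>x. K x - frac_kernel \<alpha> t x"])
      show "continuous_on UNIV (\<lambda>x. K x - frac_kernel \<alpha> t x)"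
        using K frac_kernel_continuous[OF t] by (intro continuous_intros) auto
      show "integrable lborel (\<lambda>x. K x - frac_kernel \<alpha> t x)"
        using K frac_kernel_integrable[OF t] by auto
      fix \<xi>
      have "fourier_transform (\<lambda>x. K x - frac_kernel \<alpha> t x) \<xi> = fourier_transform K \<xi> - fourier_transform (frac_kernel \<alpha> t) \<xi>"
        unfolding fourier_transform_def of_real_diff right_diff_distrib
        using K frac_kernel_integrable[OF t]
        by (intro Bochner_Integration.integral_diff integrable_cis_mult integrable_of_real) auto
      then show "fourier_transform (\<lambda>x. K x - frac_kernel \<alpha> t x) \<xi> = 0"
        using K by (simp add: fourier_transform_frac_kernel[OF t])
    qed
    then show "K = frac_kernel \<alpha> t" by auto
  qed
  then show ?thesis by (simp add: frac_heat_kernel_def)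
qed

text \<open>The function y \<mapsto> K_b(y - z) is, up to the constant, the transform of the
  modulated symbol at time b. The multiplication formula moves this transform onto K_a, whose own
  transform is the symbol at time a, and the exponentials multiply.\<close>

lemma frac_kernel_semigroup:
  fixes z :: "'a::euclidean_space"
  assumes a: "a > 0" and b: "b > 0"
  shows "has_bochner_integral lborel (\<lambda>y. frac_kernel \<alpha> a y * frac_kernel \<alpha> b (y - z)) (frac_kernel \<alpha> (a + b) z)"
proof -
  let ?C = "complex_of_real ((2 * pi) ^ DIM('a))"
  let ?\<psi> = "\<lambda>t \<xi>::'a. complex_of_real (exp (- t * norm \<xi> powr \<alpha>))"
  obtain B where B: "\<And>x::'a. frac_kernel \<alpha> b x \<le> B" using frac_kernel_bounded[OF b] by blast
  have int: "integrable lborel (\<lambda>y. frac_kernel \<alpha> a y * frac_kernel \<alpha> b (y - z))"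
  proof (rule Bochner_Integration.integrable_bound)
    show "integrable lborel (\<lambda>y::'a. frac_kernel \<alpha> a y * B)" by (intro integrable_mult_left frac_kernel_integrable a)
    show "AE y in lborel. norm (frac_kernel \<alpha> a y * frac_kernel \<alpha> b (y - z)) \<le> norm (frac_kernel \<alpha> a y * B)"
      by (auto simp: abs_mult frac_kernel_nonneg[OF b] intro!: mult_left_mono order_trans[OF B abs_ge_self])
  qed measurable
  have shift: "fourier_plus (\<lambda>\<xi>. cis (- (z \<bullet> \<xi>)) * ?\<psi> b \<xi>) y = ?C * of_real (frac_kernel \<alpha> b (y - z))" for y
    unfolding of_real_mult[symmetric] fourier_plus_exp_powr[OF b, symmetric]
    unfolding fourier_plus_def by (simp add: mult.assoc[symmetric] cis_mult inner_diff_left)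
  have "?C * of_real (LINT y|lborel. frac_kernel \<alpha> a y * frac_kernel \<alpha> b (y - z)) =
      (LINT y|lborel. fourier_plus (\<lambda>\<xi>. cis (- (z \<bullet> \<xi>)) * ?\<psi> b \<xi>) y * of_real (frac_kernel \<alpha> a y))"
    unfolding shift mult.assoc integral_mult_right_zero
    by (simp add: mult.commute flip: integral_complex_of_real)
  also have "\<dots> = (LINT \<xi>|lborel. cis (- (z \<bullet> \<xi>)) * ?\<psi> b \<xi> * fourier_plus (\<lambda>y. of_real (frac_kernel \<alpha> a y)) \<xi>)"
    by (intro fourier_plus_swap integrable_cis_mult integrable_of_real integrable_exp_powr \<alpha> a b frac_kernel_integrable) auto
  also have "\<dots> = (LINT \<xi>|lborel. cis ((- z) \<bullet> \<xi>) * ?\<psi> (a + b) \<xi>)"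
  proof (intro Bochner_Integration.integral_cong refl)
    fix \<xi> :: 'a
    have "fourier_plus (\<lambda>y. of_real (frac_kernel \<alpha> a y)) \<xi> = ?\<psi> a \<xi>"
      using fourier_transform_frac_kernel[OF a, of "- \<xi>"] by (simp add: fourier_transform_eq)
    then show "cis (- (z \<bullet> \<xi>)) * ?\<psi> b \<xi> * fourier_plus (\<lambda>y. of_real (frac_kernel \<alpha> a y)) \<xi> = cis ((- z) \<bullet> \<xi>) * ?\<psi> (a + b) \<xi>"
      by (simp add: algebra_simps flip: of_real_mult exp_add)
  qed
  also have "\<dots> = ?C * of_real (frac_kernel \<alpha> (a + b) z)"
    using fourier_plus_exp_powr[of "a + b" "- z"] a b by (simp add: fourier_plus_def frac_kernel_minus)
  finally have "(LINT y|lborel. frac_kernel \<alpha> a y * frac_kernel \<alpha> b (y - z)) = frac_kernel \<alpha> (a + b) z"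
    by (simp del: of_real_mult of_real_power)
  with int show ?thesis by (simp add: has_bochner_integral_iff)
qed

lemma frac_kernel_scaling:
  fixes x :: "'a::euclidean_space"
  assumes t: "t > 0"
  shows "frac_kernel \<alpha> t x = (t powr (- 1 / \<alpha>)) ^ DIM('a) * frac_kernel \<alpha> 1 (t powr (- 1 / \<alpha>) *\<^sub>R x)"
proof -
  define c where "c = t powr (- 1 / \<alpha>)"
  have c: "c > 0" using t by (simp add: c_def)
  have "c powr \<alpha> = 1 / t" unfolding c_def powr_powr using \<alpha> t by (simp add: powr_minus divide_inverse)
  then have *: "t * norm (c *\<^sub>R \<xi>) powr \<alpha> = norm \<xi> powr \<alpha>" for \<xi> :: 'a
    using c t by (simp add: powr_mult)
  have "fourier_plus (\<lambda>\<xi>. of_real (exp (- t * norm \<xi> powr \<alpha>))) x =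
      of_real (c ^ DIM('a)) * fourier_plus (\<lambda>\<xi>. of_real (exp (- 1 * norm \<xi> powr \<alpha>))) (c *\<^sub>R x)"
    unfolding fourier_plus_def
    by (subst integral_lborel_affine[of _ c 0]) (use c * in \<open>auto simp: scaleR_conv_of_real\<close>)
  then show ?thesis by (simp add: frac_kernel_def c_def)
qed

lemma frac_kernel_1_0_pos: "0 < frac_kernel \<alpha> 1 (0::'a::euclidean_space)"
proof -
  have int: "integrable lborel (\<lambda>\<xi>::'a. exp (- 1 * norm \<xi> powr \<alpha>))" using \<alpha> by (intro integrable_exp_powr) auto
  have "0 < (LINT \<xi>|lborel. exp (- 1 * norm (\<xi>::'a) powr \<alpha>))"
  proof (rule ccontr)
    assume "\<not> ?thesis"
    moreover have "0 \<le> (LINT \<xi>|lborel. exp (- 1 * norm (\<xi>::'a) powr \<alpha>))" by (rule integral_nonneg_AE) simp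
    ultimately have "(LINT \<xi>|lborel. exp (- 1 * norm (\<xi>::'a) powr \<alpha>)) = 0" by linarith
    then have "AE \<xi> in lborel. exp (- 1 * norm (\<xi>::'a) powr \<alpha>) = 0"
      using integral_nonneg_eq_0_iff_AE[OF int] by simp
    then show False by (simp add: AE_iff_measurable[OF _ refl])
  qed
  moreover have "fourier_plus (\<lambda>\<xi>. of_real (exp (- 1 * norm \<xi> powr \<alpha>))) (0::'a) = of_real (LINT \<xi>|lborel. exp (- 1 * norm (\<xi>::'a) powr \<alpha>))"
    unfolding fourier_plus_def by (simp flip: integral_complex_of_real)
  ultimately show ?thesis by (simp add: frac_kernel_def)
qed

text \<open>At time 1 the kernel is continuous and positive at the origin, hence at least half its
  central value on a small ball. Scaling carries this to every time.\<close>

lemma frac_kernel_lower_bound: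
  "\<exists>\<kappa>>0. \<exists>\<rho>>0. \<forall>t>0. \<forall>x::'a::euclidean_space. norm x \<le> \<rho> * t powr (1 / \<alpha>) \<longrightarrow>
    \<kappa> * t powr (- real DIM('a) / \<alpha>) \<le> frac_kernel \<alpha> t x"
proof -
  define \<kappa> where "\<kappa> = frac_kernel \<alpha> 1 (0::'a) / 2"
  have \<kappa>: "\<kappa> > 0" using frac_kernel_1_0_pos by (simp add: \<kappa>_def)
  have "isCont (frac_kernel \<alpha> 1) (0::'a)"
    using frac_kernel_continuous[of 1, where 'a = 'a] by (simp add: continuous_on_eq_continuous_at)
  then obtain r where r: "r > 0" "\<And>x::'a. dist x 0 < r \<Longrightarrow> dist (frac_kernel \<alpha> 1 x) (frac_kernel \<alpha> 1 (0::'a)) < \<kappa>"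
    using \<kappa> unfolding continuous_at_eps_delta by blast
  show ?thesis
  proof (rule exI[of _ \<kappa>], intro conjI \<kappa>, rule exI[of _ "r / 2"], intro conjI allI impI)
    fix t :: real and x :: 'a assume t: "t > 0" and x: "norm x \<le> r / 2 * t powr (1 / \<alpha>)"
    let ?c = "t powr (- 1 / \<alpha>)"
    have "norm (?c *\<^sub>R x) = ?c * norm x" by simp
    also have "\<dots> \<le> ?c * (r / 2 * t powr (1 / \<alpha>))" by (intro mult_left_mono x) simp
    also have "\<dots> = r / 2" using t by (simp add: powr_minus)
    finally have "dist (?c *\<^sub>R x) 0 < r" using r(1) by simp
    then have "\<kappa> \<le> frac_kernel \<alpha> 1 (?c *\<^sub>R x)"
      using r(2)[of "?c *\<^sub>R x"] unfolding \<kappa>_def dist_real_def by linarith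
    then have "?c ^ DIM('a) * \<kappa> \<le> frac_kernel \<alpha> t x"
      unfolding frac_kernel_scaling[OF t, of x] by (intro mult_left_mono) auto
    also have "?c ^ DIM('a) = t powr (- real DIM('a) / \<alpha>)"
      using t by (simp add: powr_powr mult.commute flip: powr_realpow)
    finally show "\<kappa> * t powr (- real DIM('a) / \<alpha>) \<le> frac_kernel \<alpha> t x" by (simp add: mult.commute)
  qed (use r in auto)
qed

end

section \<open>Blow-up\<close>

text \<open>Once \<open>w\<close> has reached \<open>2\<^sup>j a\<close> it reaches \<open>2\<^sup>j\<^sup>+\<^sup>1 a\<close> within a time \<open>c \<rho>\<^sup>j\<close>, where \<open>\<rho> = 2 powr (- \<theta>)\<close>; these times
  are summable.\<close>

lemma doubling_contradiction:
  fixes w :: "real \<Rightarrow> ennreal" and f :: "real \<Rightarrow> real"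
  assumes \<theta>: "\<theta> > 0" and a: "a > 0" "f a > 0"
    and f: "\<And>m. m \<ge> 1 \<Longrightarrow> m powr (1 + \<theta>) * f a \<le> f (a * m)"
    and T: "2 * a / f a / (1 - (1 / 2) powr \<theta>) < T"
    and base: "\<And>s. 0 \<le> s \<Longrightarrow> s < T \<Longrightarrow> ennreal a \<le> w s"
    and bdd: "\<And>s. 0 \<le> s \<Longrightarrow> s < T \<Longrightarrow> w s \<le> ennreal M"
    and step: "\<And>m \<sigma> s. 0 \<le> m \<Longrightarrow> 0 \<le> \<sigma> \<Longrightarrow> \<sigma> \<le> s \<Longrightarrow> s < T \<Longrightarrow>
      (\<And>r. \<sigma> \<le> r \<Longrightarrow> r < s \<Longrightarrow> ennreal m \<le> w r) \<Longrightarrow> ennreal (f m * (s - \<sigma>)) \<le> w s"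
  shows False
proof -
  define \<rho> where "\<rho> = (1 / 2 :: real) powr \<theta>"
  have \<rho>: "0 < \<rho>" "\<rho> < 1" using half_powr_lt_1[OF \<theta>] by (auto simp: \<rho>_def)
  \<comment> \<open>The hypothesis \<open>step\<close> bounds w by the accumulated source alone,
    without the level already reached. In each stage the source must therefore supply the full new
    level \<open>2 ^ Suc j * a\<close>, whence the factor 2.\<close>
  define c where "c = 2 * a / f a"
  have c: "c > 0" using a by (simp add: c_def)
  define \<sigma> where "\<sigma> = (\<lambda>j. \<Sum>i<j. c * \<rho> ^ i)"
  have \<sigma>0: "0 \<le> \<sigma> j" for j using c \<rho> by (auto simp: \<sigma>_def intro!: sum_nonneg)
  have sums: "(\<lambda>i. c * \<rho> ^ i) sums (c * (1 / (1 - \<rho>)))"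
    using \<rho> by (intro sums_mult geometric_sums) auto
  have \<sigma>_le: "\<sigma> j \<le> c / (1 - \<rho>)" for j
    using sum_le_suminf[OF sums_summable[OF sums], of "{..<j}"] c \<rho>
    by (simp add: \<sigma>_def sums_unique[OF sums, symmetric])
  have main: "\<forall>s. \<sigma> j \<le> s \<and> s < T \<longrightarrow> ennreal (2 ^ j * a) \<le> w s" for j
  proof (induction j)
    case 0
    then show ?case using base by (simp add: \<sigma>_def)
  next
    case (Suc j)
    show ?case
    proof (intro allI impI)
      fix s assume s: "\<sigma> (Suc j) \<le> s \<and> s < T"
      have \<sigma>S: "\<sigma> (Suc j) = \<sigma> j + c * \<rho> ^ j" by (simp add: \<sigma>_def)
      have p: "0 < c * \<rho> ^ j" using c \<rho> by simp
      have "ennreal (f (2 ^ j * a) * (s - \<sigma> j)) \<le> w s"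
        using Suc.IH s \<sigma>S p \<sigma>0[of j] a by (intro step) auto
      moreover have "2 ^ Suc j * a \<le> f (2 ^ j * a) * (s - \<sigma> j)"
      proof -
        have "(2 ^ j) powr (1 + \<theta>) * \<rho> ^ j = (2 ^ j :: real)"
        proof -
          have "\<rho> ^ j * (2 ^ j) powr \<theta> = (\<rho> * 2 powr \<theta>) ^ j"
            by (simp add: power_mult_distrib powr_power powr_powr mult.commute flip: powr_realpow)
          also have "\<rho> * 2 powr \<theta> = 1" by (simp add: \<rho>_def powr_divide)
          finally show ?thesis by (simp add: powr_add mult.assoc mult.commute)
        qed
        then have "2 ^ Suc j * a = ((2 ^ j) powr (1 + \<theta>) * f a) * (c * \<rho> ^ j)"
          using a by (simp add: c_def field_simps)
        also have "\<dots> \<le> f (2 ^ j * a) * (s - \<sigma> j)"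
          using f[of "2 ^ j"] s \<sigma>S p a order_trans[OF _ f[of "2 ^ j"]] by (intro mult_mono) (auto simp: mult.commute)
        finally show ?thesis .
      qed
      ultimately show "ennreal (2 ^ Suc j * a) \<le> w s" by (meson ennreal_leI order_trans)
    qed
  qed
  \<comment> \<open>The total of all stage lengths: at this one time, still before T, w exceeds
    every level.\<close>
  define s where "s = c / (1 - \<rho>)"
  have s: "0 \<le> s" "s < T" using c \<rho> T[folded c_def \<rho>_def] by (simp_all add: s_def)
  obtain j where "max M 0 / a < 2 ^ j" using real_arch_pow[of 2 "max M 0 / a"] by auto
  then have "max M 0 < 2 ^ j * a" using a by (simp add: field_simps)
  then have "ennreal M < ennreal (2 ^ j * a)" by (intro ennreal_lessI) auto
  also have "\<dots> \<le> w s" using main[of j] \<sigma>_le[of j] s by (simp add: s_def)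
  also have "\<dots> \<le> ennreal M" by (rule bdd[OF s])
  finally show False by simp
qed

section \<open>Integral inequalities for mild solutions\<close>

lemma nn_integral_has_bochner_integral:
  assumes "has_bochner_integral M f (x::real)" "\<And>y. 0 \<le> f y"
  shows "(\<integral>\<^sup>+y. ennreal (f y) \<partial>M) = ennreal x"
  using assms nn_integral_eq_integral[of M f] by (auto simp: has_bochner_integral_iff)

context
  fixes \<alpha> :: real
  assumes \<alpha>: "0 < \<alpha>" "\<alpha> \<le> 2"
begin

lemma frac_kernel_nn_integral:
  "t > 0 \<Longrightarrow> (\<integral>\<^sup>+(y::'a::euclidean_space). ennreal (frac_kernel \<alpha> t y) \<partial>lborel) = 1"
  using nn_integral_has_bochner_integral[OF frac_kernel_integral[OF \<alpha>, of t, where 'a = 'a]]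
  by (simp add: frac_kernel_nonneg[OF \<alpha>])

lemma frac_kernel_integral_shift:
  fixes y :: "'a::euclidean_space"
  assumes t: "t > 0"
  shows "integrable lborel (\<lambda>z. frac_kernel \<alpha> t (y - z))" "(LINT z|lborel. frac_kernel \<alpha> t (y - z)) = 1"
proof -
  have "(LINT z|lborel. frac_kernel \<alpha> t (z::'a)) = 1"
    using frac_kernel_integral[OF \<alpha> t, where 'a = 'a] by (simp add: has_bochner_integral_iff)
  then show "(LINT z|lborel. frac_kernel \<alpha> t (y - z)) = 1"
    by (subst (asm) integral_lborel_affine[of _ "- 1" y]) auto
  show "integrable lborel (\<lambda>z. frac_kernel \<alpha> t (y - z))"
    using integrable_lborel_affine[OF frac_kernel_integrable[OF \<alpha> t], of "- 1" y] by simp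
qed

text \<open>Passes from the Bochner integral in the semigroup to a non-negative integral. The bounds
  on v hold almost everywhere because initial data are given only in that sense.\<close>

lemma frac_heat_semigroup_nn:
  fixes v :: "'a::euclidean_space \<Rightarrow> real"
  assumes t: "t > 0" and [measurable]: "v \<in> borel_measurable borel" and v: "AE z in lborel. 0 \<le> v z \<and> v z \<le> B"
  shows "ennreal (frac_heat_semigroup \<alpha> t v y) = (\<integral>\<^sup>+z. ennreal (frac_kernel \<alpha> t (y - z)) * ennreal (v z) \<partial>lborel)"
    and "0 \<le> frac_heat_semigroup \<alpha> t v y" "frac_heat_semigroup \<alpha> t v y \<le> B"
proof -
  note K = frac_kernel_nonneg[OF \<alpha> t]
  have eq: "frac_heat_semigroup \<alpha> t v y = (LINT z|lborel. frac_kernel \<alpha> t (y - z) * v z)"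
    using t by (simp add: frac_heat_semigroup_def frac_heat_kernel_eq[OF \<alpha>])
  have intB: "integrable lborel (\<lambda>z. frac_kernel \<alpha> t (y - z) * B)"
    by (intro integrable_mult_left frac_kernel_integral_shift t)
  have bound: "AE z in lborel. norm (frac_kernel \<alpha> t (y - z) * v z) \<le> frac_kernel \<alpha> t (y - z) * B"
    using v by eventually_elim (auto simp: abs_mult K intro!: mult_left_mono)
  have int: "integrable lborel (\<lambda>z. frac_kernel \<alpha> t (y - z) * v z)"
    by (rule Bochner_Integration.integrable_bound[OF intB]) (use bound in auto)
  have nn: "AE z in lborel. 0 \<le> frac_kernel \<alpha> t (y - z) * v z"
    using v by eventually_elim (simp add: K)
  have "(\<integral>\<^sup>+z. ennreal (frac_kernel \<alpha> t (y - z)) * ennreal (v z) \<partial>lborel) =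
      (\<integral>\<^sup>+z. ennreal (frac_kernel \<alpha> t (y - z) * v z) \<partial>lborel)"
    using v by (intro nn_integral_cong_AE) (auto elim!: eventually_mono simp: ennreal_mult K)
  also have "\<dots> = ennreal (frac_heat_semigroup \<alpha> t v y)"
    unfolding eq by (rule nn_integral_eq_integral[OF int nn])
  finally show "ennreal (frac_heat_semigroup \<alpha> t v y) = (\<integral>\<^sup>+z. ennreal (frac_kernel \<alpha> t (y - z)) * ennreal (v z) \<partial>lborel)" ..
  show "0 \<le> frac_heat_semigroup \<alpha> t v y" unfolding eq by (rule integral_nonneg_AE[OF nn])
  have "frac_heat_semigroup \<alpha> t v y \<le> (LINT z|lborel. frac_kernel \<alpha> t (y - z) * B)"
    unfolding eq by (rule integral_mono_AE[OF int intB]) (use bound in auto)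
  also have "\<dots> = B" by (simp add: frac_kernel_integral_shift[OF t])
  finally show "frac_heat_semigroup \<alpha> t v y \<le> B" .
qed

text \<open>Tonelli's theorem and \<open>frac_kernel_semigroup\<close>. It is the semigroup law at
  the origin, where evenness of the kernel removes the reflection from the outer
  convolution.\<close>

lemma frac_kernel_compose_nn:
  fixes v :: "'a::euclidean_space \<Rightarrow> ennreal"
  assumes a: "a > 0" and b: "b > 0" and [measurable]: "v \<in> borel_measurable borel"
  shows "(\<integral>\<^sup>+y. ennreal (frac_kernel \<alpha> a y) * (\<integral>\<^sup>+z. ennreal (frac_kernel \<alpha> b (y - z)) * v z \<partial>lborel) \<partial>lborel) =
    (\<integral>\<^sup>+z. ennreal (frac_kernel \<alpha> (a + b) z) * v z \<partial>lborel)"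
proof -
  have "(\<integral>\<^sup>+y. ennreal (frac_kernel \<alpha> a y) * (\<integral>\<^sup>+z. ennreal (frac_kernel \<alpha> b (y - z)) * v z \<partial>lborel) \<partial>lborel) =
    (\<integral>\<^sup>+y. (\<integral>\<^sup>+z. ennreal (frac_kernel \<alpha> a y) * (ennreal (frac_kernel \<alpha> b (y - z)) * v z) \<partial>lborel) \<partial>lborel)"
    by (subst nn_integral_cmult) auto
  also have "\<dots> = (\<integral>\<^sup>+z. (\<integral>\<^sup>+y. ennreal (frac_kernel \<alpha> a y) * (ennreal (frac_kernel \<alpha> b (y - z)) * v z) \<partial>lborel) \<partial>lborel)"
    by (rule lborel_pair.Fubini') measurable
  also have "\<dots> = (\<integral>\<^sup>+z. ennreal (frac_kernel \<alpha> (a + b) z) * v z \<partial>lborel)"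
  proof (intro nn_integral_cong)
    fix z :: 'a
    have "(\<integral>\<^sup>+y. ennreal (frac_kernel \<alpha> a y) * (ennreal (frac_kernel \<alpha> b (y - z)) * v z) \<partial>lborel) =
      (\<integral>\<^sup>+y. ennreal (frac_kernel \<alpha> a y * frac_kernel \<alpha> b (y - z)) * v z \<partial>lborel)"
      by (intro nn_integral_cong) (simp add: ennreal_mult frac_kernel_nonneg[OF \<alpha>] a b mult.assoc)
    also have "\<dots> = (\<integral>\<^sup>+y. ennreal (frac_kernel \<alpha> a y * frac_kernel \<alpha> b (y - z)) \<partial>lborel) * v z"
      by (rule nn_integral_multc) measurable
    also have "(\<integral>\<^sup>+y. ennreal (frac_kernel \<alpha> a y * frac_kernel \<alpha> b (y - z)) \<partial>lborel) = ennreal (frac_kernel \<alpha> (a + b) z)"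
      by (rule nn_integral_has_bochner_integral[OF frac_kernel_semigroup[OF \<alpha> a b]])
         (auto simp: frac_kernel_nonneg[OF \<alpha>] a b)
    finally show "(\<integral>\<^sup>+y. ennreal (frac_kernel \<alpha> a y) * (ennreal (frac_kernel \<alpha> b (y - z)) * v z) \<partial>lborel) =
      ennreal (frac_kernel \<alpha> (a + b) z) * v z" .
  qed
  finally show ?thesis .
qed

text \<open>The kernel is the density of a probability measure. Monotonicity replaces m by the mean
  of v, and convexity then moves f inside the mean.\<close>

lemma frac_kernel_jensen:
  fixes v :: "'a::euclidean_space \<Rightarrow> real" and f :: "real \<Rightarrow> real"
  assumes t: "t > 0" and [measurable]: "v \<in> borel_measurable borel" "f \<in> borel_measurable borel"
    and v: "\<And>z. 0 \<le> v z" "\<And>z. v z \<le> M"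
    and f: "convex_on UNIV f" "\<And>x y. x \<le> y \<Longrightarrow> f x \<le> f y" "\<And>x. 0 \<le> f x"
    and m: "m \<ge> 0" "ennreal m \<le> (\<integral>\<^sup>+z. ennreal (frac_kernel \<alpha> t z) * ennreal (v z) \<partial>lborel)"
  shows "ennreal (f m) \<le> (\<integral>\<^sup>+z. ennreal (frac_kernel \<alpha> t z) * ennreal (f (v z)) \<partial>lborel)"
proof -
  note K = frac_kernel_nonneg[OF \<alpha> t]
  let ?D = "density lborel (\<lambda>z::'a. ennreal (frac_kernel \<alpha> t z))"
  interpret prob_space ?D
    by (rule prob_spaceI) (simp add: emeasure_density frac_kernel_nn_integral[OF t])
  have iv: "integrable ?D v" by (rule integrable_const_bound[of _ M]) (use v in auto)
  have fM: "norm (f (v z)) \<le> f M" for z using f v by (simp add: f(2)[OF v(2)])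
  have ifv: "integrable ?D (\<lambda>z. f (v z))" by (rule integrable_const_bound[of _ "f M"]) (use fM in auto)
  have nn: "(\<integral>\<^sup>+z. ennreal (frac_kernel \<alpha> t z) * ennreal (g z) \<partial>lborel) = ennreal (expectation g)"
    if "integrable ?D g" "\<And>z. 0 \<le> g z" and [measurable]: "g \<in> borel_measurable borel" for g
    using nn_integral_eq_integral[OF that(1)] that(2) by (simp add: nn_integral_density)
  have "ennreal m \<le> ennreal (expectation v)" using m(2) nn[OF iv v(1)] by simp
  moreover have "0 \<le> expectation v" by (rule integral_nonneg_AE) (use v in auto)
  ultimately have "f m \<le> f (expectation v)" by (intro f(2)) simp
  also have "\<dots> \<le> expectation (\<lambda>z. f (v z))"
    by (rule jensens_inequality[where I = UNIV]) (use iv ifv f in auto)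
  finally have "ennreal (f m) \<le> ennreal (expectation (\<lambda>z. f (v z)))" by (rule ennreal_leI)
  also have "\<dots> = (\<integral>\<^sup>+z. ennreal (frac_kernel \<alpha> t z) * ennreal (f (v z)) \<partial>lborel)"
    by (rule nn[symmetric, OF ifv f(3)]) measurable
  finally show ?thesis .
qed

text \<open>A non-trivial \<phi> has positive mass on some ball of radius R. As soon as
  \<open>\<rho> * t powr (1 / \<alpha>)\<close> exceeds R, the pointwise lower bound for the kernel
  holds on that whole ball.\<close>

lemma frac_kernel_mass_lower_bound:
  fixes \<phi> :: "'a::euclidean_space \<Rightarrow> real"
  assumes [measurable]: "\<phi> \<in> borel_measurable borel" and nn: "AE x in lborel. 0 \<le> \<phi> x" and nz: "\<not> (AE x in lborel. \<phi> x = 0)"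
  shows "\<exists>C>0. \<exists>t0. \<forall>t>0. t \<ge> t0 \<longrightarrow>
    ennreal (C * t powr (- real DIM('a) / \<alpha>)) \<le> (\<integral>\<^sup>+y. ennreal (frac_kernel \<alpha> t y) * ennreal (\<phi> y) \<partial>lborel)"
proof -
  obtain \<kappa> \<rho> where \<kappa>: "\<kappa> > 0" and \<rho>: "\<rho> > 0"
    and lb: "\<And>t x. t > 0 \<Longrightarrow> norm (x::'a) \<le> \<rho> * t powr (1 / \<alpha>) \<Longrightarrow> \<kappa> * t powr (- real DIM('a) / \<alpha>) \<le> frac_kernel \<alpha> t x"
    using frac_kernel_lower_bound[OF \<alpha>, where 'a = 'a] by blast
  have [measurable]: "cball (0::'a) R \<in> sets borel" for R by simp
  let ?I = "\<lambda>R. \<integral>\<^sup>+y. ennreal (\<phi> y) * indicator (cball 0 R) y \<partial>lborel"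
  have "\<exists>R::nat. ?I R \<noteq> 0"
  proof (rule ccontr)
    assume "\<not> ?thesis"
    moreover have "?I R = 0 \<longleftrightarrow> (AE y in lborel. ennreal (\<phi> y) * indicator (cball 0 R) y = 0)" for R
      by (rule nn_integral_0_iff_AE) measurable
    ultimately have "AE y in lborel. \<forall>R::nat. ennreal (\<phi> y) * indicator (cball 0 R) y = 0"
      by (subst AE_all_countable) blast
    with nn have "AE y in lborel. \<phi> y = 0"
    proof eventually_elim
      case (elim y)
      obtain R :: nat where "norm y \<le> R" using real_arch_simple by blast
      with elim(2)[rule_format, of R] elim(1) show ?case by (simp add: ennreal_eq_0_iff)
    qed
    with nz show False by simp
  qed
  then obtain R :: nat where "?I R \<noteq> 0" by blast
  then obtain m where m: "m > 0" "ennreal m \<le> ?I R"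
  proof (cases "?I R")
    case (real c)
    then have "c > 0" using \<open>?I R \<noteq> 0\<close> by (cases "c = 0") auto
    with that real show thesis by simp
  next
    case top
    show thesis by (rule that[of 1]) (simp_all add: top)
  qed
  show ?thesis
  proof (rule exI[of _ "\<kappa> * m"], intro conjI, use \<kappa> m in simp, rule exI[of _ "(real R / \<rho>) powr \<alpha>"], intro allI impI)
    fix t :: real assume t: "t > 0" "t \<ge> (real R / \<rho>) powr \<alpha>"
    have "((real R / \<rho>) powr \<alpha>) powr (1 / \<alpha>) \<le> t powr (1 / \<alpha>)" using t \<alpha> by (intro powr_mono2) auto
    then have "real R / \<rho> \<le> t powr (1 / \<alpha>)" using \<alpha> \<rho> by (simp add: powr_powr)
    then have R: "real R \<le> \<rho> * t powr (1 / \<alpha>)" using \<rho> by (simp add: field_simps)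
    let ?c = "\<kappa> * t powr (- real DIM('a) / \<alpha>)"
    have "ennreal (\<kappa> * m * t powr (- real DIM('a) / \<alpha>)) = ennreal ?c * ennreal m"
      using \<kappa> m by (simp add: mult_ac flip: ennreal_mult)
    also have "\<dots> \<le> ennreal ?c * ?I R" by (intro mult_left_mono m) simp
    also have "\<dots> = (\<integral>\<^sup>+y. ennreal ?c * (ennreal (\<phi> y) * indicator (cball 0 R) y) \<partial>lborel)"
      by (subst nn_integral_cmult) auto
    also have "\<dots> \<le> (\<integral>\<^sup>+y. ennreal (frac_kernel \<alpha> t y) * ennreal (\<phi> y) \<partial>lborel)"
      using lb[OF t(1)] R
      by (intro nn_integral_mono) (auto split: split_indicator intro!: mult_right_mono ennreal_leI)
    finally show "ennreal (\<kappa> * m * t powr (- real DIM('a) / \<alpha>)) \<le> (\<integral>\<^sup>+y. ennreal (frac_kernel \<alpha> t y) * ennreal (\<phi> y) \<partial>lborel)" .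
  qed
qed

text \<open>Both terms of the variation of constants formula are non-negative, so each alone bounds
  the solution from below. U is the solution cut off outside \<open>{0..t}\<close>, which makes it
  jointly measurable and bounded everywhere. The interval \<open>{0..<s}\<close> omits r = s, where
  the semigroup is the identity by convention and is not given by the kernel.\<close>

lemma mild_solution_lower_bounds:
  fixes u :: "real \<Rightarrow> 'a::euclidean_space \<Rightarrow> real" and \<phi> :: "'a \<Rightarrow> real" and f :: "real \<Rightarrow> real"
  assumes mild: "mild_solution \<alpha> f \<phi> T u" and t: "0 < t" "ereal t < T"
    and [measurable]: "f \<in> borel_measurable borel" "\<phi> \<in> borel_measurable borel"
    and f: "\<And>x y. x \<le> y \<Longrightarrow> f x \<le> f y" "\<And>x. 0 \<le> f x"
    and \<phi>: "AE x in lborel. 0 \<le> \<phi> x \<and> \<phi> x \<le> B"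
  obtains M U where "(\<lambda>(r, z). U r z) \<in> borel_measurable (borel \<Otimes>\<^sub>M borel)"
    and "\<And>r z. 0 \<le> U r z" "\<And>r z. U r z \<le> M" "AE y in lborel. U 0 y = \<phi> y"
    and "\<And>s. 0 < s \<Longrightarrow> s \<le> t \<Longrightarrow> AE y in lborel.
      (\<integral>\<^sup>+z. ennreal (frac_kernel \<alpha> s (y - z)) * ennreal (\<phi> z) \<partial>lborel) \<le> ennreal (U s y)"
    and "\<And>s. 0 \<le> s \<Longrightarrow> s \<le> t \<Longrightarrow> AE y in lborel.
      (\<integral>\<^sup>+r. indicator {0..<s} r * (\<integral>\<^sup>+z. ennreal (frac_kernel \<alpha> (s - r) (y - z)) * ennreal (f (U r z)) \<partial>lborel) \<partial>lborel)
        \<le> ennreal (U s y)"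
proof -
  define U where "U = (\<lambda>r z. if 0 \<le> r \<and> r \<le> t then u r z else 0)"
  have in_dom: "ereal r < T" if "r \<le> t" for r
    using that t(2) by (meson ereal_less_eq(3) le_less_trans)
  obtain M where M: "\<And>r z. 0 \<le> r \<Longrightarrow> r \<le> t \<Longrightarrow> u r z \<le> M"
    using mild t unfolding mild_solution_def by (meson atLeastAtMost_iff)
  have u0: "0 \<le> u r z" if "0 \<le> r" "r \<le> t" for r z
    using mild that in_dom unfolding mild_solution_def by blast
  have M0: "0 \<le> M" using u0[of 0 0] M[of 0 0] t(1) by simp
  have U0: "0 \<le> U r z" and UM: "U r z \<le> M" for r z using u0 M M0 by (auto simp: U_def)
  let ?A = "{r. 0 \<le> r \<and> ereal r < T} \<times> (UNIV :: 'a set)"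
  have "(\<lambda>p. indicator ({0..t} \<times> (UNIV :: 'a set)) p * (indicator ?A p *\<^sub>R (case p of (r, z) \<Rightarrow> u r z))) \<in> borel_measurable borel"
    using mild unfolding mild_solution_def set_borel_measurable_def
    by (intro borel_measurable_times borel_measurable_indicator borel_closed closed_Times) auto
  also have "(\<lambda>p. indicator ({0..t} \<times> (UNIV :: 'a set)) p * (indicator ?A p *\<^sub>R (case p of (r, z) \<Rightarrow> u r z))) = (\<lambda>(r, z). U r z)"
    using in_dom by (auto simp: U_def fun_eq_iff split: split_indicator)
  finally have Umeas [measurable]: "(\<lambda>(r, z). U r z) \<in> borel_measurable (borel \<Otimes>\<^sub>M borel)"
    by (simp add: borel_prod)
  have [measurable]: "U r \<in> borel_measurable borel" for r
    using measurable_compose[OF measurable_Pair1' Umeas, of r] by simp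
  let ?Q = "\<lambda>s y. LINT r:{0..s}|lborel. frac_heat_semigroup \<alpha> (s - r) (\<lambda>z. f (u r z)) y"
  let ?G = "\<lambda>s y r. \<integral>\<^sup>+z. ennreal (frac_kernel \<alpha> (s - r) (y - z)) * ennreal (f (U r z)) \<partial>lborel"
  have Q: "ennreal (?Q s y) = (\<integral>\<^sup>+r. indicator {0..<s} r * ?G s y r \<partial>lborel) \<and> 0 \<le> ?Q s y"
    if s: "0 \<le> s" "s \<le> t" for s y
  proof -
    \<comment> \<open>Written through \<open>?G\<close>, which is visibly measurable in r; the
      semigroup term itself does not display this. On \<open>{0..<s}\<close> the values of
      \<open>?G\<close> are finite, so \<open>enn2real\<close> loses nothing.\<close>
    define q where "q = (\<lambda>r. indicator {0..<s} r * enn2real (?G s y r))"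
    have sg: "ennreal (frac_heat_semigroup \<alpha> (s - r) (\<lambda>z. f (u r z)) y) = ?G s y r"
        "0 \<le> frac_heat_semigroup \<alpha> (s - r) (\<lambda>z. f (u r z)) y"
        "frac_heat_semigroup \<alpha> (s - r) (\<lambda>z. f (u r z)) y \<le> f M"
      if r: "0 \<le> r" "r < s" for r
    proof -
      have U: "u r = U r" using r s by (auto simp: U_def)
      have "AE z in lborel. 0 \<le> f (U r z) \<and> f (U r z) \<le> f M" using f UM by auto
      from frac_heat_semigroup_nn[OF _ _ this, of "s - r" y] r
      show "ennreal (frac_heat_semigroup \<alpha> (s - r) (\<lambda>z. f (u r z)) y) = ?G s y r"
        "0 \<le> frac_heat_semigroup \<alpha> (s - r) (\<lambda>z. f (u r z)) y"
        "frac_heat_semigroup \<alpha> (s - r) (\<lambda>z. f (u r z)) y \<le> f M" unfolding U by auto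
    qed
    have q_eq: "q r = frac_heat_semigroup \<alpha> (s - r) (\<lambda>z. f (u r z)) y" if "0 \<le> r" "r < s" for r
      using that sg(1,2)[OF that] by (simp add: q_def sg(1)[OF that, symmetric])
    have [measurable]: "q \<in> borel_measurable borel" unfolding q_def by measurable
    have q0: "0 \<le> q r" for r by (simp add: q_def)
    have qM: "norm (q r) \<le> norm (f M * indicator {0..s} r)" for r
      using q_eq[of r] sg(3)[of r] f(2)[of M] q0[of r]
      by (cases "0 \<le> r \<and> r < s") (auto simp: q_def split: split_indicator)
    have qint: "integrable lborel q"
      by (rule Bochner_Integration.integrable_bound[of _ "\<lambda>r. f M * indicator {0..s} r"])
         (use qM s in \<open>auto intro!: integrable_mult_right integrable_real_indicator\<close>)
    have "?Q s y = (LINT r|lborel. q r)"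
      unfolding set_lebesgue_integral_def
    proof (rule integral_cong_AE)
      \<comment> \<open>At r = s the semigroup returns its argument, so the integrand differs from q
        there only by a multiple of the indicator of a point.\<close>
      have "(\<lambda>r. indicator {0..s} r *\<^sub>R frac_heat_semigroup \<alpha> (s - r) (\<lambda>z. f (u r z)) y) =
          (\<lambda>r. q r + indicator {s} r * f (u s y))"
        using q_eq s by (auto simp: fun_eq_iff q_def frac_heat_semigroup_def split: split_indicator)
      then show "(\<lambda>r. indicator {0..s} r *\<^sub>R frac_heat_semigroup \<alpha> (s - r) (\<lambda>z. f (u r z)) y) \<in> borel_measurable lborel"
        by simp
      have "AE r in lborel. r \<noteq> s" by (rule AE_lborel_singleton)
      then show "AE r in lborel. indicator {0..s} r *\<^sub>R frac_heat_semigroup \<alpha> (s - r) (\<lambda>z. f (u r z)) y = q r"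
        by eventually_elim (use q_eq in \<open>auto simp: q_def split: split_indicator\<close>)
    qed measurable
    moreover have "ennreal (LINT r|lborel. q r) = (\<integral>\<^sup>+r. ennreal (q r) \<partial>lborel)"
      by (rule nn_integral_eq_integral[symmetric, OF qint]) (simp add: q0)
    moreover have "ennreal (q r) = indicator {0..<s} r * ?G s y r" for r
    proof (cases "0 \<le> r \<and> r < s")
      case True
      then show ?thesis using q_eq[of r] sg(1)[of r] by simp
    qed (auto simp: q_def split: split_indicator)
    moreover have "0 \<le> (LINT r|lborel. q r)" by (rule integral_nonneg_AE) (simp add: q0)
    ultimately show ?thesis by simp
  qed
  have eq: "AE y in lborel. U s y = frac_heat_semigroup \<alpha> s \<phi> y + ?Q s y" if "0 \<le> s" "s \<le> t" for s
    using mild that in_dom unfolding mild_solution_def U_def by auto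
  have P0: "AE y in lborel. 0 \<le> frac_heat_semigroup \<alpha> s \<phi> y" if "0 \<le> s" for s
  proof (cases "s = 0")
    case True
    then show ?thesis using \<phi> by (auto simp: frac_heat_semigroup_def elim: eventually_mono)
  next
    case False
    then show ?thesis using that frac_heat_semigroup_nn(2)[OF _ _ \<phi>] by auto
  qed
  show thesis
  proof (rule that[OF Umeas U0 UM])
    have "?Q 0 y = 0" for y
      unfolding set_lebesgue_integral_def
    proof (rule integral_eq_zero_AE)
      have "AE r in lborel. r \<noteq> (0::real)" by (rule AE_lborel_singleton)
      then show "AE r in lborel. indicator {0..0} r *\<^sub>R frac_heat_semigroup \<alpha> (0 - r) (\<lambda>z. f (u r z)) y = 0"
        by eventually_elim (simp split: split_indicator)
    qed
    then show "AE y in lborel. U 0 y = \<phi> y"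
      using eq[of 0] t(1) by (simp add: frac_heat_semigroup_def)
    show "AE y in lborel. (\<integral>\<^sup>+z. ennreal (frac_kernel \<alpha> s (y - z)) * ennreal (\<phi> z) \<partial>lborel) \<le> ennreal (U s y)"
      if s: "0 < s" "s \<le> t" for s
      using eq[of s] s
      by (auto simp: frac_heat_semigroup_nn(1)[OF _ _ \<phi>, symmetric] Q elim!: eventually_mono intro!: ennreal_leI)
    show "AE y in lborel. (\<integral>\<^sup>+r. indicator {0..<s} r * ?G s y r \<partial>lborel) \<le> ennreal (U s y)"
      if s: "0 \<le> s" "s \<le> t" for s
      using eq[OF s] P0[OF s(1)]
      by eventually_elim (simp add: Q[OF s, THEN conjunct1, symmetric] ennreal_leI)
  qed
qed

text \<open>Pushed to the origin by the semigroup over the remaining time, the free part of the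
  solution keeps w above a throughout, and the source part provides the growth step of
  \<open>doubling_contradiction\<close>. The hypothesis \<open>large\<close> says that all doublings
  fit into the lifespan t.\<close>

lemma no_mild_solution:
  fixes u :: "real \<Rightarrow> 'a::euclidean_space \<Rightarrow> real" and \<phi> :: "'a \<Rightarrow> real" and f :: "real \<Rightarrow> real"
  assumes mild: "mild_solution \<alpha> f \<phi> T u" and t: "0 < t" "ereal t < T"
    and [measurable]: "f \<in> borel_measurable borel" "\<phi> \<in> borel_measurable borel"
    and f: "convex_on UNIV f" "\<And>x y. x \<le> y \<Longrightarrow> f x \<le> f y" "\<And>x. 0 \<le> f x"
    and scale: "\<And>m. m \<ge> 1 \<Longrightarrow> m powr (1 + \<theta>) * f a \<le> f (a * m)" and \<theta>: "\<theta> > 0"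
    and \<phi>: "AE x in lborel. 0 \<le> \<phi> x \<and> \<phi> x \<le> B"
    and a: "a > 0" "f a > 0" "ennreal a \<le> (\<integral>\<^sup>+y. ennreal (frac_kernel \<alpha> t y) * ennreal (\<phi> y) \<partial>lborel)"
    and large: "2 * a / f a / (1 - (1 / 2) powr \<theta>) < t"
  shows False
proof (rule mild_solution_lower_bounds[OF mild t assms(4,5) f(2,3) \<phi>])
  fix M U assume Umeas [measurable]: "(\<lambda>(r, z). U r z) \<in> borel_measurable (borel \<Otimes>\<^sub>M borel)"
    and U: "\<And>r z. 0 \<le> U r z" "\<And>r z. U r z \<le> M" and init: "AE y in lborel. U 0 y = \<phi> y"
    and lin: "\<And>s. 0 < s \<Longrightarrow> s \<le> t \<Longrightarrow> AE y in lborel.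
      (\<integral>\<^sup>+z. ennreal (frac_kernel \<alpha> s (y - z)) * ennreal (\<phi> z) \<partial>lborel) \<le> ennreal (U s y)"
    and src: "\<And>s. 0 \<le> s \<Longrightarrow> s \<le> t \<Longrightarrow> AE y in lborel.
      (\<integral>\<^sup>+r. indicator {0..<s} r * (\<integral>\<^sup>+z. ennreal (frac_kernel \<alpha> (s - r) (y - z)) * ennreal (f (U r z)) \<partial>lborel) \<partial>lborel)
        \<le> ennreal (U s y)"
  have [measurable]: "U r \<in> borel_measurable borel" for r
    using measurable_compose[OF measurable_Pair1' Umeas, of r] by simp
  define w where "w = (\<lambda>s. \<integral>\<^sup>+y. ennreal (frac_kernel \<alpha> (t - s) y) * ennreal (U s y) \<partial>lborel)"
  show False
  proof (rule doubling_contradiction[OF \<theta> a(1,2) scale large, of w M])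
    fix s assume s: "0 \<le> s" "s < t"
    have "(\<integral>\<^sup>+y. ennreal (frac_kernel \<alpha> t y) * ennreal (\<phi> y) \<partial>lborel) \<le> w s"
    proof (cases "s = 0")
      case True
      then show ?thesis unfolding w_def
        using init by (intro nn_integral_mono_AE) (auto elim!: eventually_mono)
    next
      case False
      then have "(\<integral>\<^sup>+y. ennreal (frac_kernel \<alpha> t y) * ennreal (\<phi> y) \<partial>lborel) =
        (\<integral>\<^sup>+y. ennreal (frac_kernel \<alpha> (t - s) y) *
          (\<integral>\<^sup>+z. ennreal (frac_kernel \<alpha> s (y - z)) * ennreal (\<phi> z) \<partial>lborel) \<partial>lborel)"
        using s by (subst frac_kernel_compose_nn) auto
      also have "\<dots> \<le> w s" unfolding w_def
        using lin[of s] s False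
        by (intro nn_integral_mono_AE) (auto elim!: eventually_mono intro!: mult_left_mono)
      finally show ?thesis .
    qed
    with a(3) show "ennreal a \<le> w s" by (rule order_trans)
    have "w s \<le> (\<integral>\<^sup>+(y::'a). ennreal (frac_kernel \<alpha> (t - s) y) * ennreal M \<partial>lborel)"
      unfolding w_def using U(2) by (intro nn_integral_mono mult_left_mono ennreal_leI) auto
    also have "\<dots> = ennreal M"
      using s by (subst nn_integral_multc) (auto simp: frac_kernel_nn_integral)
    finally show "w s \<le> ennreal M" .
  next
    fix m \<sigma> s assume m: "0 \<le> m" and s: "0 \<le> \<sigma>" "\<sigma> \<le> s" "s < t"
      and w: "\<And>r. \<sigma> \<le> r \<Longrightarrow> r < s \<Longrightarrow> ennreal m \<le> w r"
    let ?G = "\<lambda>y r. \<integral>\<^sup>+z. ennreal (frac_kernel \<alpha> (s - r) (y - z)) * ennreal (f (U r z)) \<partial>lborel"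
    have "ennreal (f m * (s - \<sigma>)) = (\<integral>\<^sup>+r. ennreal (f m) * indicator {\<sigma>..<s} r \<partial>lborel)"
      using s f(3)[of m] by (subst nn_integral_cmult_indicator) (auto simp: ennreal_mult)
    also have "\<dots> \<le> (\<integral>\<^sup>+r. indicator {0..<s} r * (\<integral>\<^sup>+z. ennreal (frac_kernel \<alpha> (t - r) z) * ennreal (f (U r z)) \<partial>lborel) \<partial>lborel)"
    proof (intro nn_integral_mono)
      fix r
      have "ennreal (f m) \<le> (\<integral>\<^sup>+z. ennreal (frac_kernel \<alpha> (t - r) z) * ennreal (f (U r z)) \<partial>lborel)"
        if "\<sigma> \<le> r" "r < s"
        using that s w[OF that] by (intro frac_kernel_jensen[OF _ _ _ U f m]) (auto simp: w_def)
      then show "ennreal (f m) * indicator {\<sigma>..<s} r \<le>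
        indicator {0..<s} r * (\<integral>\<^sup>+z. ennreal (frac_kernel \<alpha> (t - r) z) * ennreal (f (U r z)) \<partial>lborel)"
        using s by (auto split: split_indicator)
    qed
    \<comment> \<open>The remaining time is split as \<open>t - r = (t - s) + (s - r)\<close>: the
      second part reproduces the source term at time s, and the first is the weight in w s.\<close>
    also have "\<dots> = (\<integral>\<^sup>+r. (\<integral>\<^sup>+y. ennreal (frac_kernel \<alpha> (t - s) y) * (indicator {0..<s} r * ?G y r) \<partial>lborel) \<partial>lborel)"
    proof (intro nn_integral_cong)
      fix r
      show "indicator {0..<s} r * (\<integral>\<^sup>+z. ennreal (frac_kernel \<alpha> (t - r) z) * ennreal (f (U r z)) \<partial>lborel) =
        (\<integral>\<^sup>+y. ennreal (frac_kernel \<alpha> (t - s) y) * (indicator {0..<s} r * ?G y r) \<partial>lborel)"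
      proof (cases "0 \<le> r \<and> r < s")
        case True
        then show ?thesis using s frac_kernel_compose_nn[of "t - s" "s - r" "\<lambda>z. ennreal (f (U r z))"] by simp
      qed auto
    qed
    also have "\<dots> = (\<integral>\<^sup>+y. (\<integral>\<^sup>+r. ennreal (frac_kernel \<alpha> (t - s) y) * (indicator {0..<s} r * ?G y r) \<partial>lborel) \<partial>lborel)"
      by (rule lborel_pair.Fubini') measurable
    also have "\<dots> = (\<integral>\<^sup>+y. ennreal (frac_kernel \<alpha> (t - s) y) * (\<integral>\<^sup>+r. indicator {0..<s} r * ?G y r \<partial>lborel) \<partial>lborel)"
      by (intro nn_integral_cong nn_integral_cmult) measurable
    also have "\<dots> \<le> w s" unfolding w_def
      using src[of s] s by (intro nn_integral_mono_AE) (auto elim!: eventually_mono intro!: mult_left_mono)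
    finally show "ennreal (f m * (s - \<sigma>)) \<le> w s" .
  qed
qed

lemma osc_blow_up:
  "blow_up_property TYPE('a::euclidean_space) \<alpha> (osc (\<alpha> / (3 * real DIM('a))))"
  unfolding blow_up_property_def
proof (intro allI impI, elim conjE exE)
  define \<theta> where "\<theta> = \<alpha> / (3 * real DIM('a))"
  have \<theta>: "\<theta> > 0" using \<alpha> by (simp add: \<theta>_def)
  fix \<phi> :: "'a \<Rightarrow> real" and B
  assume \<phi>m: "\<phi> \<in> borel_measurable lborel" and nz: "\<not> (AE x in lborel. \<phi> x = 0)"
    and \<phi>: "AE x in lborel. 0 \<le> \<phi> x \<and> \<phi> x \<le> B"
  have [measurable]: "\<phi> \<in> borel_measurable borel" using \<phi>m by simp
  have \<phi>0: "AE x in lborel. 0 \<le> \<phi> x" using \<phi> by eventually_elim simp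
  obtain C t0 where C: "C > 0" and lower: "\<And>t. t > 0 \<Longrightarrow> t \<ge> t0 \<Longrightarrow>
      ennreal (C * t powr (- real DIM('a) / \<alpha>)) \<le> (\<integral>\<^sup>+y. ennreal (frac_kernel \<alpha> t y) * ennreal (\<phi> y) \<partial>lborel)"
    using frac_kernel_mass_lower_bound[OF _ \<phi>0 nz] by auto
  define L where "L = 2 / (1 - (1 / 2 :: real) powr \<theta>)"
  define a where "a = (\<lambda>k. 2 * node k)"
  \<comment> \<open>The solution of \<open>C * t powr (- n / \<alpha>) = a k\<close>, where n is the
    dimension and \<alpha> / n = 3 * \<theta>. These times tend to infinity, hence eventually exceed
    t0.\<close>
  define t where "t = (\<lambda>k. (C / a k) powr (3 * \<theta>))"
  have a: "a k > 0" for k by (simp add: a_def)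
  have t_pos: "t k > 0" for k using C a[of k] by (simp add: t_def)
  have t_eq: "t k = C powr (3 * \<theta>) / a k powr (3 * \<theta>)" for k
    using C a[of k] by (simp add: t_def powr_divide)
  have t_inv: "C * t k powr (- real DIM('a) / \<alpha>) = a k" for k
  proof -
    have "t k powr (- real DIM('a) / \<alpha>) = (C / a k) powr (-1)"
      using \<alpha> by (simp add: t_def powr_powr \<theta>_def)
    then show ?thesis using C a[of k] by (simp add: powr_minus)
  qed
  have a_lim: "a \<longlonglongrightarrow> 0" unfolding a_def using tendsto_mult[OF tendsto_const node_tendsto_0, of 2] by simp
  have "(\<lambda>k. a k powr (3 * \<theta>)) \<longlonglongrightarrow> 0"
    using a_lim \<theta> by (intro tendsto_zero_powrI[where b = "3 * \<theta>"]) (auto simp: a less_imp_le)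
  then have "filterlim (\<lambda>k. inverse (a k powr (3 * \<theta>))) at_top sequentially"
    using a by (intro filterlim_inverse_at_top) (auto simp: less_imp_neq[OF a, symmetric])
  then have "filterlim (\<lambda>k. C powr (3 * \<theta>) * inverse (a k powr (3 * \<theta>))) at_top sequentially"
    using C by (intro filterlim_tendsto_pos_mult_at_top[OF tendsto_const]) auto
  then have "\<forall>\<^sub>F k in sequentially. t0 \<le> t k"
    by (simp add: t_eq divide_inverse filterlim_at_top)
  \<comment> \<open>The threshold is what \<open>large\<close> demands once \<open>t k\<close> is
    written as \<open>C powr (3 * \<theta>) / a k powr (3 * \<theta>)\<close> and the inequality is
    solved for the quotient.\<close>
  moreover have "\<forall>\<^sub>F k in sequentially. L / C powr (3 * \<theta>) < osc \<theta> (a k) / a k powr (1 + 3 * \<theta>)"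
    using osc_twice_node_ratio[OF \<theta>] by (simp add: filterlim_at_top_dense a_def)
  ultimately have "\<forall>\<^sub>F k in sequentially. t0 \<le> t k \<and> L / C powr (3 * \<theta>) < osc \<theta> (a k) / a k powr (1 + 3 * \<theta>)"
    by eventually_elim simp
  then obtain k where k: "t0 \<le> t k" "L / C powr (3 * \<theta>) < osc \<theta> (a k) / a k powr (1 + 3 * \<theta>)"
    by (auto dest: eventually_happens)
  have f_pos: "0 < osc \<theta> (a k)"
  proof -
    have "0 < node k powr (1 + 2 * \<theta>)" by (simp add: less_imp_neq[OF node_pos, symmetric])
    then show ?thesis using osc_twice_node_ge[OF \<theta>, of k] unfolding a_def by linarith
  qed
  have large: "2 * a k / osc \<theta> (a k) / (1 - (1 / 2) powr \<theta>) < t k"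
  proof -
    have "a k powr (1 + 3 * \<theta>) = a k * a k powr (3 * \<theta>)" using a[of k] by (simp add: powr_add)
    then have "L * (a k * a k powr (3 * \<theta>)) < osc \<theta> (a k) * C powr (3 * \<theta>)"
      using k(2) C a[of k] by (simp add: field_simps)
    then have "L * a k / osc \<theta> (a k) < t k"
      using f_pos a[of k] by (simp add: t_eq field_simps)
    then show ?thesis by (simp add: L_def mult.commute)
  qed
  have "max_existence_time \<alpha> (osc \<theta>) \<phi> < \<infinity>"
  proof (rule ccontr)
    assume "\<not> ?thesis"
    then have "ereal (t k) < Sup {T. 0 < T \<and> (\<exists>u. mild_solution \<alpha> (osc \<theta>) \<phi> T u)}"
      by (simp add: max_existence_time_def)
    then obtain T u where T: "ereal (t k) < T" "mild_solution \<alpha> (osc \<theta>) \<phi> T u"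
      by (auto simp: less_Sup_iff)
    show False
    proof (rule no_mild_solution[OF T(2) t_pos T(1)])
      show "ennreal (a k) \<le> (\<integral>\<^sup>+y. ennreal (frac_kernel \<alpha> (t k) y) * ennreal (\<phi> y) \<partial>lborel)"
        using lower[OF t_pos k(1)] by (simp only: t_inv)
      show "2 * a k / osc \<theta> (a k) / (1 - (1 / 2) powr \<theta>) < t k" by (rule large)
      show "m powr (1 + \<theta>) * osc \<theta> (a k) \<le> osc \<theta> (a k * m)" if "m \<ge> 1" for m
        by (rule osc_scale[OF \<theta> that])
    qed (use \<theta> a f_pos \<phi> osc_convex osc_mono osc_nonneg osc_measurable in auto)
  qed
  then show "max_existence_time \<alpha> (osc (\<alpha> / (3 * real DIM('a)))) \<phi> < \<infinity>" by (simp only: \<theta>_def)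
qed

end

theorem mainTheorem2:
  fixes \<alpha> :: real
  assumes "0 < \<alpha>" and "\<alpha> \<le> 2"
  shows "\<exists>f :: real \<Rightarrow> real. f \<in> {0..} \<rightarrow> {0..} \<and>
    condition_M f \<and> convex_on {0<..} f \<and> condition_B f \<and> condition_S f \<and>
    (\<forall>\<delta>>0. (\<integral>\<^sup>+u\<in>{0<..<\<delta>}. ennreal (f u / u powr (2 + \<alpha> / real CARD('n::finite))) \<partial>lborel) = \<infinity>) \<and>
    blow_up_property TYPE(real ^ 'n) \<alpha> f \<and>
    Liminf (at_right 0) (\<lambda>u. ereal (f u / u powr (1 + \<alpha> / real CARD('n)))) = 0 \<and>
    Liminf (at_right 0) (\<lambda>l. ereal (f (l\<^sup>2) / (l powr (1 + \<alpha> / real CARD('n)) * f l))) = 0 \<and>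
    (\<alpha> = 2 \<longrightarrow>
      \<not> (\<exists>c0\<in>{0<..1}. \<forall>l m. 0 < l \<and> l \<le> m \<and> l \<in> {0<..<c0} \<and> l * m \<in> {0<..<c0} \<longrightarrow>
            c0 * m powr (1 + 2 / real CARD('n)) * f l \<le> f (l * m)))"
proof -
  define \<theta> where "\<theta> = \<alpha> / (3 * real CARD('n))"
  have \<theta>: "\<theta> > 0" using assms(1) by (simp add: \<theta>_def)
  have eq: "\<alpha> / real CARD('n) = 3 * \<theta>" by (simp add: \<theta>_def)
  have sqrt_lim: "(\<lambda>k. sqrt (node k)) \<longlonglongrightarrow> 0"
    using tendsto_real_sqrt[OF node_tendsto_0] by simp
  have sqrt_ratio: "(\<lambda>k. osc \<theta> ((sqrt (node k))\<^sup>2) / (sqrt (node k) powr (1 + \<alpha> / real CARD('n)) * osc \<theta> (sqrt (node k)))) \<longlonglongrightarrow> 0"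
    unfolding eq by (rule osc_sqrt_node_ratio[OF \<theta>])
  show ?thesis
  proof (intro exI[of _ "osc \<theta>"] conjI impI allI)
    show "osc \<theta> \<in> {0..} \<rightarrow> {0..}" using osc_nonneg[OF \<theta>] by auto
    show "condition_M (osc \<theta>)" "condition_B (osc \<theta>)" "condition_S (osc \<theta>)"
      by (rule osc_condition_M[OF \<theta>] osc_condition_B[OF \<theta>] osc_condition_S[OF \<theta>])+
    show "convex_on {0<..} (osc \<theta>)" by (rule convex_on_subset[OF osc_convex[OF \<theta>]]) auto
    show "(\<integral>\<^sup>+u\<in>{0<..<\<delta>}. ennreal (osc \<theta> u / u powr (2 + \<alpha> / real CARD('n))) \<partial>lborel) = \<infinity>" if "\<delta> > 0" for \<delta>
      unfolding eq by (rule osc_integral_diverges[OF \<theta> that])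
    show "blow_up_property TYPE(real ^ 'n) \<alpha> (osc \<theta>)"
      using osc_blow_up[OF assms, where 'a = "real ^ 'n"] by (simp add: \<theta>_def)
    show "Liminf (at_right 0) (\<lambda>u. ereal (osc \<theta> u / u powr (1 + \<alpha> / real CARD('n)))) = 0"
      unfolding eq
      by (rule Liminf_at_right_0_eq_0[OF _ node_pos node_tendsto_0 osc_node_ratio[OF \<theta>]])
         (simp add: osc_nonneg[OF \<theta>])
    show "Liminf (at_right 0) (\<lambda>l. ereal (osc \<theta> (l\<^sup>2) / (l powr (1 + \<alpha> / real CARD('n)) * osc \<theta> l))) = 0"
      by (rule Liminf_at_right_0_eq_0[OF _ _ sqrt_lim sqrt_ratio]) (simp_all add: osc_nonneg[OF \<theta>])
    show "\<not> (\<exists>c0\<in>{0<..1}. \<forall>l m. 0 < l \<and> l \<le> m \<and> l \<in> {0<..<c0} \<and> l * m \<in> {0<..<c0} \<longrightarrow>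
            c0 * m powr (1 + 2 / real CARD('n)) * osc \<theta> l \<le> osc \<theta> (l * m))" if "\<alpha> = 2"
    proof
      assume "\<exists>c0\<in>{0<..1}. \<forall>l m. 0 < l \<and> l \<le> m \<and> l \<in> {0<..<c0} \<and> l * m \<in> {0<..<c0} \<longrightarrow>
            c0 * m powr (1 + 2 / real CARD('n)) * osc \<theta> l \<le> osc \<theta> (l * m)"
      then obtain c0 where c0: "0 < c0" "c0 \<le> 1"
        and H: "\<And>l m. 0 < l \<and> l \<le> m \<and> l \<in> {0<..<c0} \<and> l * m \<in> {0<..<c0} \<Longrightarrow>
            c0 * m powr (1 + 2 / real CARD('n)) * osc \<theta> l \<le> osc \<theta> (l * m)" by auto
      have "\<forall>\<^sub>F k in sequentially. sqrt (node k) < c0 \<and>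
        osc \<theta> ((sqrt (node k))\<^sup>2) / (sqrt (node k) powr (1 + \<alpha> / real CARD('n)) * osc \<theta> (sqrt (node k))) < c0"
        using order_tendstoD(2)[OF sqrt_lim c0(1)] order_tendstoD(2)[OF sqrt_ratio c0(1)] by eventually_elim simp
      then obtain k where k: "sqrt (node k) < c0"
        "osc \<theta> ((sqrt (node k))\<^sup>2) / (sqrt (node k) powr (1 + \<alpha> / real CARD('n)) * osc \<theta> (sqrt (node k))) < c0"
        by (auto dest: eventually_happens)
      \<comment> \<open>Taking m = l turns the assumed inequality into the lower bound c0 for the
        quotient of the second limit inferior, which is smaller than c0 for this k.\<close>
      define l where "l = sqrt (node k)"
      have l: "0 < l" "l < c0" using k(1) by (auto simp: l_def)
      then have "l * l < c0" using c0 mult_strict_mono[of l c0 l 1] by simp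
      then have "c0 * l powr (1 + 2 / real CARD('n)) * osc \<theta> l \<le> osc \<theta> (l * l)"
        using l by (intro H) auto
      moreover have "0 < osc \<theta> l"
      proof -
        have "0 < (1 / 4) powr (1 + \<theta>) * l powr (1 + 3 * \<theta>)" using l by simp
        then show ?thesis using osc_sqrt_node_ge[OF \<theta>, of k] unfolding l_def by linarith
      qed
      ultimately have "c0 \<le> osc \<theta> (l * l) / (l powr (1 + 2 / real CARD('n)) * osc \<theta> l)"
        using l by (simp add: pos_le_divide_eq mult.assoc)
      then show False using k(2) that unfolding l_def[symmetric] by (simp add: power2_eq_square)
    qed
  qed
qed

end
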